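(* Fix $n\in\{1,\dots,N\}$ and let the value $\boldsymbol u_{\tau,h}(t_{n-1})\in\boldsymbol V_h^{\mathrm{div}}$ be given. The set of all solutions $(\boldsymbol u_{\tau,h},p_{\tau,h})\in\mathbb P_1(I_n;\boldsymbol V_h)\times\mathbb P_1(I_n;Q_h)$ of the space-time problem (ST) on $I_n=(t_{n-1},t_n]$ is exactly the set of all pairs of the form $$\boldsymbol u_{\tau,h}(t)=\boldsymbol u_h^{n-1}\varphi_{n,0}(t)+\overline{\boldsymbol u}_h^{\,n}\varphi_{n,1}(t),\qquad p_{\tau,h}(t)=p_h^{n-1}\varphi_{n,0}(t)+\overline p_h^{\,n}\varphi_{n,1}(t),\qquad t\in I_n,$$ where the coefficient $\boldsymbol u_h^{n-1}=\boldsymbol u_{\tau,h}^+(t_{n-1})$ equals the given value $\boldsymbol u_{\tau,h}(t_{n-1})$, the pair of coefficients $(\overline{\boldsymbol u}_h^{\,n},\overline p_h^{\,n})=(\boldsymbol u_{\tau,h}(\bar t_n),p_{\tau,h}(\bar t_n))\in\boldsymbol V_h\times Q_h$ is the unique solution of the space problem (S), and the coefficient $p_h^{n-1}=p_{\tau,h}^+(t_{n-1})\in Q_h$ can be chosen arbitrarily.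
   Context: Let $d\in\{2,3\}$, $\Omega\subset\mathbb R^d$ an open bounded domain, $T>0$, $\overline I=[0,T]$; $\langle\cdot,\cdot\rangle$ and $\|\cdot\|$ denote the inner product and norm of $L^2(\Omega)$ (scalar-, vector- or matrix-valued), $\|\cdot\|_1$ the norm of $H^1(\Omega)$. Let $\boldsymbol V=H^1_0(\Omega)^d$, $Q=\{q\in L^2(\Omega):\int_\Omega q\,dx=0\}$. Time mesh: $0=t_0<t_1<\dots<t_N=T$, $I_n=(t_{n-1},t_n]$, $\tau_n=t_n-t_{n-1}$, $\bar t_n=(t_{n-1}+t_n)/2$. $\mathbb P_k(J;B)$ is the space of $B$-valued polynomials in $t\in J$ of degree at most $k$. $w^+(t_{n-1})$ is the right-sided limit at $t_{n-1}$ of a function given on $I_n$. $\boldsymbol V_h\subset\boldsymbol V$ and $Q_h\subset Q$ are finite-dimensional (finite element) spaces satisfying the inf-sup condition $0<\beta\le\inf_{q_h\in Q_h\setminus\{0\}}\sup_{\boldsymbol v_h\in\boldsymbol V_h\setminus\{0\}}\frac{-\langle\nabla\cdot\boldsymbol v_h,q_h\rangle}{\|\boldsymbol v_h\|_1\|q_h\|}$. $\boldsymbol V_h^{\mathrm{div}}=\{\boldsymbol v_h\in\boldsymbol V_h:\langle\nabla\cdot\boldsymbol v_h,q_h\rangle=0\ \forall q_h\in Q_h\}$. Operators: $\langle A_h\boldsymbol u,\boldsymbol v_h\rangle=\langle\nabla\boldsymbol u,\nabla\boldsymbol v_h\rangle$, $\langle B_h\boldsymbol v,q_h\rangle=-\langle\nabla\cdot\boldsymbol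 v,q_h\rangle$, $\langle B_h'q,\boldsymbol v_h\rangle=-\langle\nabla\cdot\boldsymbol v_h,q\rangle$ for $\boldsymbol u,\boldsymbol v\in\boldsymbol V$, $q\in Q$, $\boldsymbol v_h\in\boldsymbol V_h$, $q_h\in Q_h$. The force satisfies $\boldsymbol f\in C(\overline I;L^2(\Omega)^d)$. Problem (ST) on $I_n$: for given $\boldsymbol u_h^{n-1}:=\boldsymbol u_{\tau,h}(t_{n-1})\in\boldsymbol V_h^{\mathrm{div}}$, find $(\boldsymbol u_{\tau,h},p_{\tau,h})\in\mathbb P_1(I_n;\boldsymbol V_h)\times\mathbb P_1(I_n;Q_h)$ such that $\boldsymbol u_{\tau,h}^+(t_{n-1})=\boldsymbol u_h^{n-1}$ and $$\int_{t_{n-1}}^{t_n}\big(\langle\partial_t\boldsymbol u_{\tau,h},\boldsymbol v_{\tau,h}\rangle+\langle A_h\boldsymbol u_{\tau,h},\boldsymbol v_{\tau,h}\rangle+\langle B_h'p_{\tau,h},\boldsymbol v_{\tau,h}\rangle\big)dt=\tfrac{\tau_n}{2}\big(\langle\boldsymbol f(t_{n-1}),\boldsymbol v_{\tau,h}\rangle+\langle\boldsymbol f(t_n),\boldsymbol v_{\tau,h}\rangle\big),\qquad\int_{t_{n-1}}^{t_n}\langle B_h\boldsymbol u_{\tau,h},q_{\tau,h}\rangle dt=0$$ for all $(\boldsymbol v_{\tau,h},q_{\tau,h})\in\mathbb P_0(I_n;\boldsymbol V_h)\times\mathbb P_0(I_n;Q_h)$ (functions constant in time). Problem (S) on $I_n$: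 for given $\boldsymbol u_h^{n-1}:=\boldsymbol u_{\tau,h}(t_{n-1})\in\boldsymbol V_h^{\mathrm{div}}$, find $(\overline{\boldsymbol u}_h^{\,n},\overline p_h^{\,n})\in\boldsymbol V_h\times Q_h$ such that for all $(\boldsymbol v_h,q_h)\in\boldsymbol V_h\times Q_h$ $$\langle\overline{\boldsymbol u}_h^{\,n}-\boldsymbol u_h^{n-1},\boldsymbol v_h\rangle+\tfrac{\tau_n}{2}\langle A_h\overline{\boldsymbol u}_h^{\,n}+B_h'\overline p_h^{\,n},\boldsymbol v_h\rangle=\tfrac{\tau_n}{4}\langle\boldsymbol f(t_{n-1})+\boldsymbol f(t_n),\boldsymbol v_h\rangle,\qquad\langle B_h\overline{\boldsymbol u}_h^{\,n},q_h\rangle=0.$$ The Lagrange basis $\varphi_{n,0},\varphi_{n,1}\in\mathbb P_1(\overline I_n;\mathbb R)$ is defined by $\varphi_{n,0}(t_{n-1})=1$, $\varphi_{n,0}(\bar t_n)=0$, $\varphi_{n,1}(t_{n-1})=0$, $\varphi_{n,1}(\bar t_n)=1$. *)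

theory Defs
  imports "HOL-Analysis.Analysis"
begin

section \<open>Square-integrable functions modulo equality almost everywhere\<close>

definition square_integrable :: "('a::euclidean_space \<Rightarrow> 'b::euclidean_space) \<Rightarrow> bool" where
  "square_integrable f \<longleftrightarrow>
     f \<in> borel_measurable lebesgue \<and> integrable lebesgue (\<lambda>x. (norm (f x))\<^sup>2)"

definition L2_rel :: "('a::euclidean_space \<Rightarrow> 'b::euclidean_space) \<Rightarrow> ('a \<Rightarrow> 'b) \<Rightarrow> bool" where
  "L2_rel f g \<longleftrightarrow> square_integrable f \<and> square_integrable g \<and> (AE x in lebesgue. f x = g x)"

lemma square_integrable_zero: "square_integrable (\<lambda>x. 0)"
  by (simp add: square_integrable_def)

lemma square_integrable_inner:
  assumes f: "square_integrable f" and g: "square_integrable g"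
  shows "integrable lebesgue (\<lambda>x. f x \<bullet> g x)"
proof (rule Bochner_Integration.integrable_bound)
  show "integrable lebesgue (\<lambda>x. (norm (f x))\<^sup>2 + (norm (g x))\<^sup>2)"
    using f g by (auto simp: square_integrable_def)
  show "(\<lambda>x. f x \<bullet> g x) \<in> borel_measurable lebesgue"
    using f g by (auto simp: square_integrable_def)
  have "\<bar>f x \<bullet> g x\<bar> \<le> (norm (f x))\<^sup>2 + (norm (g x))\<^sup>2" for x
  proof -
    have "\<bar>f x \<bullet> g x\<bar> \<le> norm (f x) * norm (g x)"
      by (rule Cauchy_Schwarz_ineq2)
    moreover have "2 * (norm (f x) * norm (g x)) \<le> (norm (f x))\<^sup>2 + (norm (g x))\<^sup>2"
      using sum_squares_bound[of "norm (f x)" "norm (g x)"] by (simp add: mult.assoc)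
    moreover have "0 \<le> norm (f x) * norm (g x)" by simp
    ultimately show ?thesis by linarith
  qed
  then show "AE x in lebesgue. norm (f x \<bullet> g x) \<le> norm ((norm (f x))\<^sup>2 + (norm (g x))\<^sup>2)"
    by simp
qed

lemma square_integrable_scaleR:
  "square_integrable f \<Longrightarrow> square_integrable (\<lambda>x. c *\<^sub>R f x)"
  by (auto simp: square_integrable_def power_mult_distrib)

lemma square_integrable_add:
  assumes f: "square_integrable f" and g: "square_integrable g"
  shows "square_integrable (\<lambda>x. f x + g x)"
proof -
  have "(norm (f x + g x))\<^sup>2 = (norm (f x))\<^sup>2 + 2 * (f x \<bullet> g x) + (norm (g x))\<^sup>2" for x
    by (simp add: power2_norm_eq_inner inner_add_left inner_add_right inner_commute)
  then show ?thesis
    using f g square_integrable_inner[OF f g] by (auto simp: square_integrable_def)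
qed

lemma square_integrable_uminus: "square_integrable f \<Longrightarrow> square_integrable (\<lambda>x. - f x)"
  using square_integrable_scaleR[of f "-1"] by simp

lemma square_integrable_diff:
  "square_integrable f \<Longrightarrow> square_integrable g \<Longrightarrow> square_integrable (\<lambda>x. f x - g x)"
  using square_integrable_add[of f "\<lambda>x. - g x"] square_integrable_uminus[of g] by simp

lemma square_integrable_nth:
  fixes f :: "'a::euclidean_space \<Rightarrow> 'b::euclidean_space ^ 'd"
  assumes f: "square_integrable f"
  shows "square_integrable (\<lambda>x. f x $ i)"
  unfolding square_integrable_def
proof
  have *: "(\<lambda>y::'b^'d. y $ i) \<in> borel_measurable borel"
    by (intro borel_measurable_continuous_onI continuous_intros)
  show m: "(\<lambda>x. f x $ i) \<in> borel_measurable lebesgue"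
    using measurable_compose[OF _ *, of f lebesgue] f by (auto simp: square_integrable_def)
  show "integrable lebesgue (\<lambda>x. (norm (f x $ i))\<^sup>2)"
  proof (rule Bochner_Integration.integrable_bound)
    show "integrable lebesgue (\<lambda>x. (norm (f x))\<^sup>2)"
      using f by (simp add: square_integrable_def)
    show "(\<lambda>x. (norm (f x $ i))\<^sup>2) \<in> borel_measurable lebesgue"
      using m by simp
    show "AE x in lebesgue. norm ((norm (f x $ i))\<^sup>2) \<le> norm ((norm (f x))\<^sup>2)"
      by (simp add: power_mono Finite_Cartesian_Product.norm_nth_le)
  qed
qed

lemma square_integrable_vec:
  fixes F :: "'d::finite \<Rightarrow> 'a::euclidean_space \<Rightarrow> 'b::euclidean_space"
  assumes F: "\<And>i. square_integrable (F i)"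
  shows "square_integrable (\<lambda>x. \<chi> i. F i x)"
  unfolding square_integrable_def
proof
  show "(\<lambda>x. \<chi> i. F i x) \<in> borel_measurable lebesgue"
  proof (subst borel_measurable_euclidean_space, intro ballI)
    fix b :: "'b^'d"
    assume "b \<in> Basis"
    have "(\<lambda>x. \<Sum>i\<in>UNIV. F i x \<bullet> b $ i) \<in> borel_measurable lebesgue"
      using F by (intro borel_measurable_sum borel_measurable_inner) (auto simp: square_integrable_def)
    then show "(\<lambda>x. (\<chi> i. F i x) \<bullet> b) \<in> borel_measurable lebesgue"
      by (simp add: inner_vec_def)
  qed
  have "(norm ((\<chi> i. F i x) :: 'b^'d))\<^sup>2 = (\<Sum>i\<in>UNIV. (norm (F i x))\<^sup>2)" for x
    by (simp add: power2_norm_eq_inner inner_vec_def)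
  then show "integrable lebesgue (\<lambda>x. (norm ((\<chi> i. F i x) :: 'b^'d))\<^sup>2)"
    using F by (auto simp: square_integrable_def)
qed

quotient_type (overloaded) ('a, 'b) L2 = "'a::euclidean_space \<Rightarrow> 'b::euclidean_space" / partial: L2_rel
proof (rule part_equivpI)
  show "\<exists>x::'a \<Rightarrow> 'b. L2_rel x x"
    using square_integrable_zero by (auto simp: L2_rel_def)
  show "symp (L2_rel :: ('a \<Rightarrow> 'b) \<Rightarrow> _)"
    by (auto simp: symp_def L2_rel_def)
  show "transp (L2_rel :: ('a \<Rightarrow> 'b) \<Rightarrow> _)"
    unfolding transp_def L2_rel_def by auto
qed

lift_definition L2_nth :: "('a::euclidean_space, 'b::euclidean_space ^ 'd) L2 \<Rightarrow> 'd \<Rightarrow> ('a, 'b) L2"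
  is "\<lambda>f i x. f x $ i"
  unfolding L2_rel_def by (auto intro: square_integrable_nth)

lift_definition L2_vec :: "('d::finite \<Rightarrow> ('a::euclidean_space, 'b::euclidean_space) L2) \<Rightarrow> ('a, 'b ^ 'd) L2"
  is "\<lambda>F x. \<chi> i. F i x"
proof -
  fix F G :: "'d \<Rightarrow> 'a \<Rightarrow> 'b"
  assume *: "\<And>i. L2_rel (F i) (G i)"
  have "AE x in lebesgue. \<forall>i. F i x = G i x"
    using * by (simp add: L2_rel_def AE_all_countable)
  then show "L2_rel (\<lambda>x. \<chi> i. F i x) (\<lambda>x. \<chi> i. G i x)"
    using * by (auto simp: L2_rel_def intro!: square_integrable_vec)
qed

instantiation L2 :: (euclidean_space, euclidean_space) real_inner
begin

lift_definition zero_L2 :: "('a, 'b) L2" is "\<lambda>x. 0"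
  by (simp add: L2_rel_def square_integrable_zero)

lift_definition plus_L2 :: "('a, 'b) L2 \<Rightarrow> ('a, 'b) L2 \<Rightarrow> ('a, 'b) L2" is "\<lambda>f g x. f x + g x"
  unfolding L2_rel_def by (auto intro: square_integrable_add)

lift_definition minus_L2 :: "('a, 'b) L2 \<Rightarrow> ('a, 'b) L2 \<Rightarrow> ('a, 'b) L2" is "\<lambda>f g x. f x - g x"
  unfolding L2_rel_def by (auto intro: square_integrable_diff)

lift_definition uminus_L2 :: "('a, 'b) L2 \<Rightarrow> ('a, 'b) L2" is "\<lambda>f x. - f x"
  unfolding L2_rel_def by (auto intro: square_integrable_uminus)

lift_definition scaleR_L2 :: "real \<Rightarrow> ('a, 'b) L2 \<Rightarrow> ('a, 'b) L2" is "\<lambda>c f x. c *\<^sub>R f x"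
  unfolding L2_rel_def by (auto intro: square_integrable_scaleR)

lift_definition inner_L2 :: "('a, 'b) L2 \<Rightarrow> ('a, 'b) L2 \<Rightarrow> real"
  is "\<lambda>f g. LINT x|lebesgue. f x \<bullet> g x"
proof -
  fix f f' g g' :: "'a \<Rightarrow> 'b"
  assume "L2_rel f f'" and "L2_rel g g'"
  then have "AE x in lebesgue. f x \<bullet> g x = f' x \<bullet> g' x"
    and "square_integrable f" "square_integrable f'" "square_integrable g" "square_integrable g'"
    by (auto simp: L2_rel_def)
  then show "(LINT x|lebesgue. f x \<bullet> g x) = (LINT x|lebesgue. f' x \<bullet> g' x)"
    by (intro integral_cong_AE) (auto simp: square_integrable_def)
qed

definition norm_L2 :: "('a, 'b) L2 \<Rightarrow> real" where
  "norm_L2 u = sqrt (inner u u)"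

definition sgn_L2 :: "('a, 'b) L2 \<Rightarrow> ('a, 'b) L2" where
  "sgn_L2 u = inverse (norm u) *\<^sub>R u"

definition dist_L2 :: "('a, 'b) L2 \<Rightarrow> ('a, 'b) L2 \<Rightarrow> real" where
  "dist_L2 u v = norm (u - v)"

definition uniformity_L2 :: "(('a, 'b) L2 \<times> ('a, 'b) L2) filter" where
  "uniformity_L2 = (INF e\<in>{0<..}. principal {(u, v). dist u v < e})"

definition open_L2 :: "('a, 'b) L2 set \<Rightarrow> bool" where
  "open_L2 U \<longleftrightarrow> (\<forall>u\<in>U. eventually (\<lambda>(u', v). u' = u \<longrightarrow> v \<in> U) uniformity)"

instance
proof
  fix u v w :: "('a, 'b) L2" and a b :: real
  show "dist u v = norm (u - v)" by (rule dist_L2_def)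
  show "sgn u = inverse (norm u) *\<^sub>R u" by (rule sgn_L2_def)
  show "(uniformity :: (('a, 'b) L2 \<times> ('a, 'b) L2) filter) =
      (INF e\<in>{0<..}. principal {(u, v). dist u v < e})"
    by (rule uniformity_L2_def)
  show "open U \<longleftrightarrow> (\<forall>u\<in>U. eventually (\<lambda>(u', v). u' = u \<longrightarrow> v \<in> U) uniformity)"
    for U :: "('a, 'b) L2 set"
    by (rule open_L2_def)
  show "norm u = sqrt (inner u u)" by (rule norm_L2_def)
  show "u + v + w = u + (v + w)"
    by transfer
      (auto simp: L2_rel_def algebra_simps intro!: square_integrable_add)
  show "u + v = v + u"
    by transfer (auto simp: L2_rel_def algebra_simps intro!: square_integrable_add)
  show "0 + u = u"
    by transfer (auto simp: L2_rel_def)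
  show "- u + u = 0"
    by transfer (auto simp: L2_rel_def intro: square_integrable_zero)
  show "u - v = u + - v"
    by transfer (auto simp: L2_rel_def intro!: square_integrable_diff)
  show "a *\<^sub>R (u + v) = a *\<^sub>R u + a *\<^sub>R v"
    by transfer (auto simp: L2_rel_def scaleR_add_right
        intro!: square_integrable_add square_integrable_scaleR)
  show "(a + b) *\<^sub>R u = a *\<^sub>R u + b *\<^sub>R u"
    by transfer (auto simp: L2_rel_def scaleR_add_left
        intro!: square_integrable_add square_integrable_scaleR)
  show "a *\<^sub>R b *\<^sub>R u = (a * b) *\<^sub>R u"
    by transfer (auto simp: L2_rel_def intro!: square_integrable_scaleR)
  show "1 *\<^sub>R u = u"
    by transfer (auto simp: L2_rel_def)
  show "inner u v = inner v u"
    by transfer (simp add: inner_commute)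
  show "inner (u + v) w = inner u w + inner v w"
    by transfer (auto simp: L2_rel_def inner_add_left intro!: Bochner_Integration.integral_add
        square_integrable_inner)
  show "inner (a *\<^sub>R u) v = a * inner u v"
    by transfer simp
  show "0 \<le> inner u u"
    by transfer simp
  show "inner u u = 0 \<longleftrightarrow> u = 0"
  proof transfer
    fix f :: "'a \<Rightarrow> 'b"
    assume "L2_rel f f"
    then have f: "square_integrable f" by (simp add: L2_rel_def)
    have "(LINT x|lebesgue. f x \<bullet> f x) = 0 \<longleftrightarrow> (AE x in lebesgue. f x \<bullet> f x = 0)"
      by (rule integral_nonneg_eq_0_iff_AE[OF square_integrable_inner[OF f f]]) simp
    then show "(LINT x|lebesgue. f x \<bullet> f x) = 0 \<longleftrightarrow> L2_rel f (\<lambda>x. 0)"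
      using f by (simp add: L2_rel_def square_integrable_zero)
  qed
qed

end

text \<open>\<open>L\<^sup>2(\<Omega>)\<close> is realised as the space of classes that vanish almost everywhere
  outside \<open>\<Omega>\<close> (extension by zero), so the inner product and norm of the type \<open>L2\<close>
  restrict to those of \<open>L\<^sup>2(\<Omega>)\<close>. Matrix-valued functions carry the Frobenius product, which
  is the library inner product on \<open>real ^ 'd ^ 'd\<close>.\<close>

definition L2_on :: "'a::euclidean_space set \<Rightarrow> ('a, 'b::euclidean_space) L2 set" where
  "L2_on \<Omega> = {u. AE x in lebesgue. x \<notin> \<Omega> \<longrightarrow> rep_L2 u x = 0}"

section \<open>Sobolev spaces\<close>

definition partial_deriv :: "'d::finite \<Rightarrow> (real ^ 'd \<Rightarrow> real) \<Rightarrow> real ^ 'd \<Rightarrow> real" where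
  "partial_deriv j \<phi> x = frechet_derivative \<phi> (at x) (axis j 1)"

primrec cont_diff :: "nat \<Rightarrow> (real ^ 'd::finite \<Rightarrow> real) \<Rightarrow> bool" where
  "cont_diff 0 \<phi> \<longleftrightarrow> continuous_on UNIV \<phi>"
| "cont_diff (Suc k) \<phi> \<longleftrightarrow>
     (\<forall>x. \<phi> differentiable (at x)) \<and> (\<forall>j. cont_diff k (partial_deriv j \<phi>))"

text \<open>\<open>C\<^sub>c\<^sup>\<infinity>(\<Omega>)\<close>, again with functions extended by zero to the whole space.\<close>

definition test_functions :: "(real ^ 'd::finite) set \<Rightarrow> (real ^ 'd \<Rightarrow> real) set" where
  "test_functions \<Omega> =
     {\<phi>. (\<forall>k. cont_diff k \<phi>) \<and> compact (closure {x. \<phi> x \<noteq> 0}) \<and> closure {x. \<phi> x \<noteq> 0} \<subseteq> \<Omega>}"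

definition is_weak_pderiv ::
    "(real ^ 'd::finite) set \<Rightarrow> 'd \<Rightarrow> (real ^ 'd, real) L2 \<Rightarrow> (real ^ 'd, real) L2 \<Rightarrow> bool" where
  "is_weak_pderiv \<Omega> j u w \<longleftrightarrow> w \<in> L2_on \<Omega> \<and>
     (\<forall>\<phi>\<in>test_functions \<Omega>.
        (LINT x:\<Omega>|lebesgue. rep_L2 u x * partial_deriv j \<phi> x)
          = - (LINT x:\<Omega>|lebesgue. rep_L2 w x * \<phi> x))"

text \<open>Weak derivatives, when they exist, are unique elements of \<open>L2_on \<Omega>\<close>; \<open>weak_pderiv\<close>
  is only meaningful for those \<open>u\<close> that have one.\<close>

definition weak_pderiv ::
    "(real ^ 'd::finite) set \<Rightarrow> 'd \<Rightarrow> (real ^ 'd, real) L2 \<Rightarrow> (real ^ 'd, real) L2" where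
  "weak_pderiv \<Omega> j u = (THE w. is_weak_pderiv \<Omega> j u w)"

definition grad :: "(real ^ 'd::finite) set \<Rightarrow> (real ^ 'd, real) L2 \<Rightarrow> (real ^ 'd, real ^ 'd) L2" where
  "grad \<Omega> u = L2_vec (\<lambda>j. weak_pderiv \<Omega> j u)"

definition H1 :: "(real ^ 'd::finite) set \<Rightarrow> (real ^ 'd, real) L2 set" where
  "H1 \<Omega> = {u \<in> L2_on \<Omega>. \<forall>j. \<exists>w. is_weak_pderiv \<Omega> j u w}"

definition H1_norm :: "(real ^ 'd::finite) set \<Rightarrow> (real ^ 'd, real) L2 \<Rightarrow> real" where
  "H1_norm \<Omega> u = sqrt ((norm u)\<^sup>2 + (norm (grad \<Omega> u))\<^sup>2)"

text \<open>The closure of \<open>C\<^sub>c\<^sup>\<infinity>(\<Omega>)\<close> in \<open>H\<^sup>1(\<Omega>)\<close>.\<close>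

definition H10 :: "(real ^ 'd::finite) set \<Rightarrow> (real ^ 'd, real) L2 set" where
  "H10 \<Omega> = {u \<in> H1 \<Omega>. \<forall>\<epsilon>>0. \<exists>\<phi>\<in>test_functions \<Omega>. H1_norm \<Omega> (u - abs_L2 \<phi>) < \<epsilon>}"

text \<open>Vector fields: row \<open>i\<close> of \<open>Grad \<Omega> v\<close> is the gradient of the \<open>i\<close>-th component of \<open>v\<close>.\<close>

definition Grad :: "(real ^ 'd::finite) set \<Rightarrow> (real ^ 'd, real ^ 'd) L2 \<Rightarrow> (real ^ 'd, real ^ 'd ^ 'd) L2" where
  "Grad \<Omega> v = L2_vec (\<lambda>i. grad \<Omega> (L2_nth v i))"

definition Div :: "(real ^ 'd::finite) set \<Rightarrow> (real ^ 'd, real ^ 'd) L2 \<Rightarrow> (real ^ 'd, real) L2" where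
  "Div \<Omega> v = (\<Sum>i\<in>UNIV. weak_pderiv \<Omega> i (L2_nth v i))"

definition V_norm :: "(real ^ 'd::finite) set \<Rightarrow> (real ^ 'd, real ^ 'd) L2 \<Rightarrow> real" where
  "V_norm \<Omega> v = sqrt ((norm v)\<^sup>2 + (norm (Grad \<Omega> v))\<^sup>2)"

definition V_space :: "(real ^ 'd::finite) set \<Rightarrow> (real ^ 'd, real ^ 'd) L2 set" where
  "V_space \<Omega> = {v. \<forall>i. L2_nth v i \<in> H10 \<Omega>}"

definition Q_space :: "(real ^ 'd::finite) set \<Rightarrow> (real ^ 'd, real) L2 set" where
  "Q_space \<Omega> = {q \<in> L2_on \<Omega>. (LINT x:\<Omega>|lebesgue. rep_L2 q x) = 0}"

section \<open>Discrete spaces and operators\<close>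

definition finite_dim_subspace :: "'v::real_vector set \<Rightarrow> bool" where
  "finite_dim_subspace S \<longleftrightarrow> subspace S \<and> (\<exists>B. finite B \<and> S = span B)"

text \<open>Infimum and supremum are taken in the extended reals, so that the infimum over the empty
  set is \<open>\<infinity>\<close> and the supremum over the empty set is \<open>-\<infinity>\<close>.\<close>

definition inf_sup_condition ::
    "(real ^ 'd::finite) set \<Rightarrow> (real ^ 'd, real ^ 'd) L2 set \<Rightarrow> (real ^ 'd, real) L2 set \<Rightarrow> real \<Rightarrow> bool" where
  "inf_sup_condition \<Omega> Vh Qh \<beta> \<longleftrightarrow> 0 < \<beta> \<and>
     ereal \<beta> \<le> (INF q\<in>Qh - {0}. SUP v\<in>Vh - {0}.
        ereal (- inner (Div \<Omega> v) q / (V_norm \<Omega> v * norm q)))"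

definition Vh_div ::
    "(real ^ 'd::finite) set \<Rightarrow> (real ^ 'd, real ^ 'd) L2 set \<Rightarrow> (real ^ 'd, real) L2 set
      \<Rightarrow> (real ^ 'd, real ^ 'd) L2 set" where
  "Vh_div \<Omega> Vh Qh = {v \<in> Vh. \<forall>q\<in>Qh. inner (Div \<Omega> v) q = 0}"

text \<open>The three operators are the Riesz representatives in the finite-dimensional spaces; the
  element described by \<open>THE\<close> exists and is unique for the finite-dimensional spaces
  \<open>Vh\<close> and \<open>Qh\<close>.\<close>

definition A_h ::
    "(real ^ 'd::finite) set \<Rightarrow> (real ^ 'd, real ^ 'd) L2 set \<Rightarrow> (real ^ 'd, real ^ 'd) L2
      \<Rightarrow> (real ^ 'd, real ^ 'd) L2" where
  "A_h \<Omega> Vh u = (THE w. w \<in> Vh \<and> (\<forall>v\<in>Vh. inner w v = inner (Grad \<Omega> u) (Grad \<Omega> v)))"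

definition B_h ::
    "(real ^ 'd::finite) set \<Rightarrow> (real ^ 'd, real) L2 set \<Rightarrow> (real ^ 'd, real ^ 'd) L2
      \<Rightarrow> (real ^ 'd, real) L2" where
  "B_h \<Omega> Qh v = (THE r. r \<in> Qh \<and> (\<forall>q\<in>Qh. inner r q = - inner (Div \<Omega> v) q))"

definition B_h' ::
    "(real ^ 'd::finite) set \<Rightarrow> (real ^ 'd, real ^ 'd) L2 set \<Rightarrow> (real ^ 'd, real) L2
      \<Rightarrow> (real ^ 'd, real ^ 'd) L2" where
  "B_h' \<Omega> Vh q = (THE w. w \<in> Vh \<and> (\<forall>v\<in>Vh. inner w v = - inner (Div \<Omega> v) q))"

section \<open>The space-time problem and the space problem\<close>

text \<open>Functions on \<open>J\<close> are encoded extensionally (fixed value outside \<open>J\<close>), so that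
  equality of elements of \<open>poly_space k J B\<close> is equality on \<open>J\<close>.\<close>

definition poly_space :: "nat \<Rightarrow> real set \<Rightarrow> 'v::real_vector set \<Rightarrow> (real \<Rightarrow> 'v) set" where
  "poly_space k J B =
     {w \<in> extensional J. \<exists>c. (\<forall>i\<le>k. c i \<in> B) \<and> (\<forall>s\<in>J. w s = (\<Sum>i\<le>k. s ^ i *\<^sub>R c i))}"

text \<open>Both problems are posed on \<open>(a, b]\<close> with initial value \<open>u\<^sub>0\<close>. Test functions
  in the space-time problem are constant in time, so \<open>v b\<close> is that constant.\<close>

definition ST_solutions ::
    "(real ^ 'd::finite) set \<Rightarrow> (real ^ 'd, real ^ 'd) L2 set \<Rightarrow> (real ^ 'd, real) L2 set
      \<Rightarrow> (real \<Rightarrow> (real ^ 'd, real ^ 'd) L2) \<Rightarrow> real \<Rightarrow> real \<Rightarrow> (real ^ 'd, real ^ 'd) L2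
      \<Rightarrow> ((real \<Rightarrow> (real ^ 'd, real ^ 'd) L2) \<times> (real \<Rightarrow> (real ^ 'd, real) L2)) set" where
  "ST_solutions \<Omega> Vh Qh f a b u\<^sub>0 = {(u, p).
     u \<in> poly_space 1 {a<..b} Vh \<and> p \<in> poly_space 1 {a<..b} Qh \<and>
     (u \<longlongrightarrow> u\<^sub>0) (at_right a) \<and>
     (\<forall>v\<in>poly_space 0 {a<..b} Vh.
        (LBINT s:{a<..b}. inner (vector_derivative u (at s within {a<..b})) (v s)
            + inner (A_h \<Omega> Vh (u s)) (v s) + inner (B_h' \<Omega> Vh (p s)) (v s))
        = (b - a) / 2 * (inner (f a) (v b) + inner (f b) (v b))) \<and>
     (\<forall>q\<in>poly_space 0 {a<..b} Qh. (LBINT s:{a<..b}. inner (B_h \<Omega> Qh (u s)) (q s)) = 0)}"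

definition S_solutions ::
    "(real ^ 'd::finite) set \<Rightarrow> (real ^ 'd, real ^ 'd) L2 set \<Rightarrow> (real ^ 'd, real) L2 set
      \<Rightarrow> (real \<Rightarrow> (real ^ 'd, real ^ 'd) L2) \<Rightarrow> real \<Rightarrow> real \<Rightarrow> (real ^ 'd, real ^ 'd) L2
      \<Rightarrow> ((real ^ 'd, real ^ 'd) L2 \<times> (real ^ 'd, real) L2) set" where
  "S_solutions \<Omega> Vh Qh f a b u\<^sub>0 = {(u, p). u \<in> Vh \<and> p \<in> Qh \<and>
     (\<forall>v\<in>Vh. inner (u - u\<^sub>0) v + (b - a) / 2 * inner (A_h \<Omega> Vh u + B_h' \<Omega> Vh p) v
        = (b - a) / 4 * inner (f a + f b) v) \<and>
     (\<forall>q\<in>Qh. inner (B_h \<Omega> Qh u) q = 0)}"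

text \<open>The function on \<open>J\<close> with coefficients \<open>x\<close>, \<open>y\<close> in the basis \<open>\<phi>\<^sub>0\<close>, \<open>\<phi>\<^sub>1\<close>.\<close>

definition nodal :: "real set \<Rightarrow> (real \<Rightarrow> real) \<Rightarrow> (real \<Rightarrow> real) \<Rightarrow> 'v::real_vector \<Rightarrow> 'v \<Rightarrow> real \<Rightarrow> 'v" where
  "nodal J \<phi>\<^sub>0 \<phi>\<^sub>1 x y = (\<lambda>s\<in>J. \<phi>\<^sub>0 s *\<^sub>R x + \<phi>\<^sub>1 s *\<^sub>R y)"

end

theory Submission
  imports Defs
begin

text \<open>
  A pair of functions that are affine in time is the same as its values at the left end point and
  at the midpoint of the interval. Tested with functions that are constant in time, the space-time
  problem contains only time integrals of affine functions, and the midpoint rule is exact for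
  these. The time derivative is the constant \<open>2 (y - x) / (b - a)\<close> for end point value \<open>x\<close> and
  midpoint value \<open>y\<close>. Hence the space-time problem says precisely that the velocity starts in the
  given value and that the midpoint values solve the space problem; the end point value of the
  pressure occurs nowhere and is free (\<open>nodal_ST_iff\<close>, \<open>ST_eq\<close>).

  The space problem is a saddle point problem on finite-dimensional spaces
  (\<open>saddle_point_unique_solution\<close>). On the discretely divergence free functions the velocity is the
  Riesz representative of the right-hand side for the positive definite form
  \<open>\<langle>u, v\<rangle> + k \<langle>\<nabla>u, \<nabla>v\<rangle>\<close>; the residual annihilates these functions, hence lies in the range of the
  discrete gradient, which gives the pressure. The inf-sup condition makes the discrete gradient
  injective and thereby the pressure unique.

  All of this rests on linearity of the discrete operators, hence of the weak derivatives. Weak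
  derivatives are linear because they are unique, which is the fundamental lemma of the calculus of
  variations (\<open>fundamental_lemma_calculus_of_variations\<close>). It is proved from explicit smooth cutoff
  functions that converge to the indicators of boxes.
\<close>

section \<open>Smooth cutoff functions\<close>

text \<open>Division by \<open>x\<^sup>m\<close> makes the family closed under differentiation up to linear combinations
  (\<open>DERIV_flat\<close>), so that smoothness of the whole family follows by induction without ever
  writing down a higher derivative of \<open>exp (- 1 / x)\<close>.\<close>

definition flat :: "nat \<Rightarrow> real \<Rightarrow> real" where
  "flat m x = (if 0 < x then exp (- (1 / x)) / x ^ m else 0)"

text \<open>Under \<open>y = 1 / x\<close> this is the fact that \<open>exp y\<close> outgrows \<open>y\<^sup>m\<close>.\<close>

lemma flat_tendsto_0: "(flat m \<longlongrightarrow> 0) (at 0)"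
proof (rule filterlim_split_at)
  show "(flat m \<longlongrightarrow> 0) (at_left 0)"
    by (rule tendsto_eventually) (auto simp: flat_def eventually_at_filter)
  have "((\<lambda>x. inverse x ^ m / exp (inverse x)) \<longlongrightarrow> (0::real)) (at_right 0)"
    by (rule filterlim_compose[OF tendsto_power_div_exp_0 filterlim_inverse_at_top_right])
  moreover have "eventually (\<lambda>x. inverse x ^ m / exp (inverse x) = flat m x) (at_right 0)"
    by (auto simp: flat_def eventually_at_filter exp_minus field_simps)
  ultimately show "(flat m \<longlongrightarrow> 0) (at_right 0)"
    using tendsto_cong by force
qed

lemma DERIV_flat:
  "(flat m has_real_derivative flat (m + 2) x - real m * flat (m + 1) x) (at x)"
proof (cases x "0::real" rule: linorder_cases)
  case less
  have "((\<lambda>_. 0) has_real_derivative 0) (at x)" by simp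
  then have "(flat m has_real_derivative 0) (at x)"
    by (rule has_field_derivative_transform_within_open[where S = "{..<0}"]) (use less in \<open>auto simp: flat_def\<close>)
  then show ?thesis using less by (simp add: flat_def)
next
  case equal
  \<comment> \<open>The difference quotient of \<open>flat m\<close> at \<open>0\<close> is \<open>flat (Suc m)\<close>.\<close>
  have "((\<lambda>h. (flat m (0 + h) - flat m 0) / h) \<longlongrightarrow> 0) (at 0)"
    by (rule Lim_transform_eventually[OF flat_tendsto_0[of "Suc m"]])
      (auto simp: flat_def eventually_at_filter)
  then show ?thesis using equal by (simp add: DERIV_def flat_def)
next
  case greater
  have pow: "x ^ m = x * x ^ (m - 1)" if "0 < m"
    using that by (cases m) auto
  have "((\<lambda>x. exp (- (1 / x)) / x ^ m) has_real_derivative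
      flat (m + 2) x - real m * flat (m + 1) x) (at x)"
    using greater
    by (cases "m = 0")
      (auto intro!: derivative_eq_intros simp: flat_def divide_simps power2_eq_square algebra_simps pow)
  then show ?thesis
    by (rule has_field_derivative_transform_within_open[where S = "{0<..}"]) (use greater in \<open>auto simp: flat_def\<close>)
qed

lemma partial_deriv_eq:
  "(\<phi> has_derivative \<phi>') (at x) \<Longrightarrow> partial_deriv j \<phi> x = \<phi>' (axis j 1)"
  unfolding partial_deriv_def using frechet_derivative_at by metis

lemma cont_diff_Suc_D: "cont_diff (Suc k) \<phi> \<Longrightarrow> cont_diff k \<phi>"
proof (induction k arbitrary: \<phi>)
  case 0
  then show ?case
    by (auto intro!: continuous_at_imp_continuous_on differentiable_imp_continuous_within)
qed auto

lemma cont_diff_const: "cont_diff k (\<lambda>x. c)"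
proof (induction k arbitrary: c)
  case (Suc k)
  have "partial_deriv j (\<lambda>x. c) = (\<lambda>x. 0)" for j :: 'a
    by (rule ext) (subst partial_deriv_eq[OF has_derivative_const], rule refl)
  then show ?case using Suc by simp
qed simp

lemma cont_diff_add:
  "cont_diff k \<phi> \<Longrightarrow> cont_diff k \<psi> \<Longrightarrow> cont_diff k (\<lambda>x. \<phi> x + \<psi> x)"
proof (induction k arbitrary: \<phi> \<psi>)
  case (Suc k)
  have "partial_deriv j (\<lambda>x. \<phi> x + \<psi> x) = (\<lambda>x. partial_deriv j \<phi> x + partial_deriv j \<psi> x)" for j
  proof
    fix x
    have "(\<phi> has_derivative frechet_derivative \<phi> (at x)) (at x)"
      "(\<psi> has_derivative frechet_derivative \<psi> (at x)) (at x)"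
      using Suc.prems by (simp_all flip: frechet_derivative_works)
    from partial_deriv_eq[OF has_derivative_add[OF this]]
    show "partial_deriv j (\<lambda>x. \<phi> x + \<psi> x) x = partial_deriv j \<phi> x + partial_deriv j \<psi> x"
      by (simp add: partial_deriv_def)
  qed
  then show ?case using Suc by simp
qed (simp add: continuous_on_add)

lemma cont_diff_mult:
  "cont_diff k \<phi> \<Longrightarrow> cont_diff k \<psi> \<Longrightarrow> cont_diff k (\<lambda>x. \<phi> x * \<psi> x)"
proof (induction k arbitrary: \<phi> \<psi>)
  case (Suc k)
  have "partial_deriv j (\<lambda>x. \<phi> x * \<psi> x) =
      (\<lambda>x. \<phi> x * partial_deriv j \<psi> x + partial_deriv j \<phi> x * \<psi> x)" for j
  proof
    fix x
    have "(\<phi> has_derivative frechet_derivative \<phi> (at x)) (at x)"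
      "(\<psi> has_derivative frechet_derivative \<psi> (at x)) (at x)"
      using Suc.prems by (simp_all flip: frechet_derivative_works)
    from partial_deriv_eq[OF has_derivative_mult[OF this]]
    show "partial_deriv j (\<lambda>x. \<phi> x * \<psi> x) x =
        \<phi> x * partial_deriv j \<psi> x + partial_deriv j \<phi> x * \<psi> x"
      by (simp add: partial_deriv_def)
  qed
  moreover have "cont_diff k \<phi>" "cont_diff k \<psi>"
    using Suc.prems cont_diff_Suc_D by blast+
  ultimately show ?case using Suc by (auto intro!: cont_diff_add)
qed (simp add: continuous_on_mult)

lemma cont_diff_prod:
  "finite I \<Longrightarrow> (\<And>i. i \<in> I \<Longrightarrow> cont_diff k (\<phi> i)) \<Longrightarrow> cont_diff k (\<lambda>x. \<Prod>i\<in>I. \<phi> i x)"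
  by (induction I rule: finite_induct) (auto simp: cont_diff_const cont_diff_mult)

text \<open>A partial derivative of the function is again a combination of two functions of the same kind,
  with \<open>m + 1\<close> and \<open>m + 2\<close> in place of \<open>m\<close>; hence the induction is on the order of
  differentiability with \<open>m\<close> arbitrary.\<close>

lemma cont_diff_flat: "cont_diff k (\<lambda>x. flat m (c * x $ i + d))"
proof (induction k arbitrary: m)
  case 0
  have "continuous_on UNIV (flat m)"
    by (intro continuous_at_imp_continuous_on ballI DERIV_isCont[OF DERIV_flat])
  then show ?case
    by (auto intro!: continuous_on_compose2[of UNIV "flat m"] continuous_intros)
next
  case (Suc k)
  let ?F = "\<lambda>m (x::real^'a). flat m (c * x $ i + d)"
  have D: "(?F m has_derivative
      (\<lambda>h. (flat (m + 2) (c * x $ i + d) - real m * flat (m + 1) (c * x $ i + d)) * (c * h $ i))) (at x)" for x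
  proof -
    have "((\<lambda>x::real^'a. c * x $ i + d) has_derivative (\<lambda>h. c * h $ i)) (at x)"
      by (auto intro!: derivative_eq_intros bounded_linear_imp_has_derivative simp: bounded_linear_vec_nth)
    then show ?thesis
      using has_derivative_compose DERIV_flat[unfolded has_field_derivative_def] by blast
  qed
  have "partial_deriv j (?F m) = (\<lambda>x. (if i = j then c else 0) * ?F (m + 2) x
      + (if i = j then - real m * c else 0) * ?F (m + 1) x)" for j
    by (rule ext) (subst partial_deriv_eq[OF D], auto simp: axis_def algebra_simps)
  moreover have "cont_diff k (\<lambda>x. p * ?F (m + 2) x + q * ?F (m + 1) x)" for p q
    by (intro cont_diff_add cont_diff_mult cont_diff_const Suc.IH)
  ultimately show ?case
    using D[THEN differentiableI] by (simp del: One_nat_def add_2_eq_Suc')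
qed

text \<open>Since \<open>flat 0\<close> is positive exactly on the positive half line and tends to \<open>1\<close> at infinity,
  scaling its argument by \<open>Suc k\<close> makes the product approach the indicator of the open box
  while its support stays the same.\<close>

definition cutoff :: "(real ^ 'd::finite) \<Rightarrow> real ^ 'd \<Rightarrow> nat \<Rightarrow> real ^ 'd \<Rightarrow> real" where
  "cutoff a b k x = (\<Prod>i\<in>UNIV. flat 0 (real (Suc k) * (x $ i - a $ i)) * flat 0 (real (Suc k) * (b $ i - x $ i)))"

lemma cutoff_eq_0: "x \<notin> box a b \<Longrightarrow> cutoff a b k x = 0"
  by (force simp: cutoff_def flat_def mem_box_cart zero_less_mult_iff)

lemma cutoff_range: "0 \<le> cutoff a b k x" "cutoff a b k x \<le> 1"
proof -
  have "0 \<le> flat 0 s \<and> flat 0 s \<le> 1" for s by (simp add: flat_def)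
  then show "0 \<le> cutoff a b k x" "cutoff a b k x \<le> 1"
    unfolding cutoff_def by (auto intro!: prod_nonneg prod_le_1 mult_le_one)
qed

lemma cutoff_tendsto: "(\<lambda>k. cutoff a b k x) \<longlonglongrightarrow> indicator (box a b) x"
proof (cases "x \<in> box a b")
  case True
  have "(\<lambda>k. flat 0 (real (Suc k) * s)) \<longlonglongrightarrow> 1" if "0 < s" for s
  proof -
    have "filterlim (\<lambda>k. s * real (Suc k)) at_top sequentially"
      using that
      by (intro filterlim_tendsto_pos_mult_at_top[OF tendsto_const]
          filterlim_compose[OF filterlim_real_sequentially filterlim_Suc])
    then have "(\<lambda>k. - (1 / (real (Suc k) * s))) \<longlonglongrightarrow> - 0"
      unfolding mult.commute[of _ s]
      by (intro tendsto_minus tendsto_divide_0[OF tendsto_const] filterlim_at_top_imp_at_infinity)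
    then have "(\<lambda>k. exp (- (1 / (real (Suc k) * s)))) \<longlonglongrightarrow> 1"
      using tendsto_exp by fastforce
    then show ?thesis using that by (simp add: flat_def)
  qed
  then have "(\<lambda>k. cutoff a b k x) \<longlonglongrightarrow> (\<Prod>i\<in>(UNIV::'a set). 1 * 1)"
    unfolding cutoff_def using True
    by (intro tendsto_prod tendsto_mult) (auto simp: mem_box_cart)
  then show ?thesis using True by simp
qed (simp add: cutoff_eq_0)

lemma cutoff_test_function:
  assumes "cbox a b \<subseteq> \<Omega>"
  shows "cutoff a b k \<in> test_functions \<Omega>"
proof -
  have "cont_diff l (cutoff a b k)" for l
    unfolding cutoff_def[abs_def]
    using cont_diff_flat[of l 0 "Suc k" _ "- (Suc k * a $ _)"] cont_diff_flat[of l 0 "- Suc k" _ "Suc k * b $ _"]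
    by (intro cont_diff_prod cont_diff_mult) (simp_all add: algebra_simps)
  moreover have sub: "closure {x. cutoff a b k x \<noteq> 0} \<subseteq> cbox a b"
    by (rule closure_minimal[OF _ closed_cbox]) (use cutoff_eq_0 box_subset_cbox in blast)
  moreover have "compact (closure {x. cutoff a b k x \<noteq> 0})"
    using sub bounded_subset[OF bounded_cbox] by (auto simp: compact_eq_bounded_closed)
  ultimately show ?thesis
    using assms by (auto simp: test_functions_def)
qed

section \<open>The fundamental lemma of the calculus of variations\<close>

text \<open>Boxes form an intersection-stable generator of the Borel sets, so the integral of \<open>g\<close> vanishes
  over every Borel set. The Lebesgue measurable \<open>g\<close> is first replaced by a Borel function
  that agrees with it almost everywhere.\<close>

lemma AE_zero_if_box_integrals_zero:
  fixes g :: "'a::euclidean_space \<Rightarrow> real"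
  assumes int: "integrable lebesgue g"
    and zero: "\<And>c d. (LINT x:box c d|lebesgue. g x) = 0"
  shows "AE x in lebesgue. g x = 0"
proof -
  have "g \<in> borel_measurable (completion lborel)" using int by simp
  from completion_ex_borel_measurable_real[OF this]
  obtain g' where g': "g' \<in> borel_measurable lborel" and ae: "AE x in lborel. g x = g' x"
    by blast
  have ae': "AE x in lebesgue. g x = g' x" using ae by (rule AE_completion)
  have meas: "g' \<in> borel_measurable lebesgue"
    using g' by (rule measurable_completion)
  have int': "integrable lborel g'"
    using integrable_cong_AE[OF _ meas ae'] int integrable_completion[OF g'] by auto
  have box0: "(LINT x:box c d|lborel. g' x) = 0" for c d
  proof -
    have "(LINT x:box c d|lborel. g' x) = (LINT x:box c d|lebesgue. g' x)"
      unfolding set_lebesgue_integral_def using g' by (subst integral_completion) auto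
    also have "\<dots> = (LINT x:box c d|lebesgue. g x)"
      unfolding set_lebesgue_integral_def
      using ae' int meas by (intro integral_cong_AE borel_measurable_scaleR borel_measurable_indicator) auto
    finally show ?thesis using zero by simp
  qed
  have whole: "(LINT x:UNIV|lborel. g' x) = 0"
  proof -
    let ?A = "\<lambda>i::nat. box (- (real i *\<^sub>R One)) (real i *\<^sub>R One) :: 'a set"
    have "(\<lambda>i. LINT x:?A i|lborel. g' x) \<longlonglongrightarrow> (LINT x:(\<Union>i. ?A i)|lborel. g' x)"
    proof (rule set_integral_cont_up)
      show "incseq ?A" by (auto simp: incseq_def mem_box) force+
      show "set_integrable lborel (\<Union>i. ?A i) g'"
        unfolding set_integrable_def using int' by (intro integrable_mult_indicator) auto
    qed auto
    moreover have "(\<Union>i. ?A i) = UNIV" by (rule UN_box_eq_UNIV)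
    ultimately show ?thesis using box0 by (simp add: LIMSEQ_const_iff)
  qed
  have sub_int: "set_integrable lborel A g'" if "A \<in> sets borel" for A
    unfolding set_integrable_def using int' that by (intro integrable_mult_indicator) auto
  have "(LINT x:A|lborel. g' x) = 0" if "A \<in> sets lborel" for A
  proof -
    have A: "A \<in> sigma_sets UNIV (range (\<lambda>(a, b). box a b :: 'a set))"
      using that sets_measure_of[of "range (\<lambda>(a, b). box a b :: 'a set)" UNIV]
      by (simp add: borel_eq_box)
    have stable: "Int_stable (range (\<lambda>(a, b). box a b :: 'a set))"
      by (auto simp: Int_stable_def box_Int_box)
    have sub: "range (\<lambda>(a, b). box a b :: 'a set) \<subseteq> Pow UNIV" by simp
    show ?thesis
      using stable sub A
    proof (induction rule: sigma_sets_induct_disjoint)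
      case (basic A)
      then show ?case using box0 by auto
    next
      case empty
      show ?case by (simp add: set_lebesgue_integral_def)
    next
      case (compl A)
      then have A: "A \<in> sets borel"
        using sets_measure_of[of "range (\<lambda>(a, b). box a b :: 'a set)" UNIV]
        by (simp add: borel_eq_box)
      have "(LINT x:A \<union> (UNIV - A)|lborel. g' x) =
          (LINT x:A|lborel. g' x) + (LINT x:UNIV - A|lborel. g' x)"
        using A by (intro set_integral_Un sub_int) auto
      moreover have "A \<union> (UNIV - A) = UNIV" by auto
      ultimately show ?case using compl whole by simp
    next
      case (union A)
      have A: "A i \<in> sets borel" for i
        using union(2) sets_measure_of[of "range (\<lambda>(a, b). box a b :: 'a set)" UNIV]
        by (auto simp: borel_eq_box)
      have "(LINT x:(\<Union>i. A i)|lborel. g' x) = (\<Sum>i. LINT x:A i|lborel. g' x)"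
        using A union(1)
        by (intro lebesgue_integral_countable_add sub_int) (auto simp: disjoint_family_on_def)
      then show ?case using union by simp
    qed
  qed
  then have "AE x in lborel. g' x = 0"
    by (intro density_unique_real[OF int']) (auto simp: set_lebesgue_integral_def)
  then have "AE x in lebesgue. g' x = 0" by (rule AE_completion)
  with ae' show ?thesis by eventually_elim simp
qed

lemma square_integrable_imp_integrable_on_cbox:
  fixes w :: "'a::euclidean_space \<Rightarrow> real"
  assumes "square_integrable w"
  shows "integrable lebesgue (\<lambda>x. indicator (cbox a b) x * w x)"
proof -
  have "square_integrable (indicator (cbox a b) :: 'a \<Rightarrow> real)"
    unfolding square_integrable_def
  proof
    have "(\<lambda>x. (norm (indicator (cbox a b) x :: real))\<^sup>2) = indicator (cbox a b)"
      by (auto simp: indicator_def)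
    then show "integrable lebesgue (\<lambda>x. (norm (indicator (cbox a b) x :: real))\<^sup>2)"
      by (simp add: integrable_indicator_iff emeasure_lborel_cbox_finite less_top[symmetric] emeasure_lborel_cbox_eq)
  qed (auto intro: borel_measurable_indicator)
  from square_integrable_inner[OF this assms] show ?thesis by simp
qed

text \<open>The cutoffs of a box whose closure lies in \<open>\<Omega>\<close> are dominated by the indicator of the closed
  box and converge to the indicator of the open one. Dominated convergence turns orthogonality to
  all test functions into vanishing integrals over all such boxes, hence \<open>w\<close> vanishes almost
  everywhere on each of them, and countably many of them cover \<open>\<Omega>\<close>.\<close>

theorem fundamental_lemma_calculus_of_variations:
  fixes w :: "real ^ 'd::finite \<Rightarrow> real"
  assumes "open \<Omega>" and w: "square_integrable w"
    and zero: "\<And>\<phi>. \<phi> \<in> test_functions \<Omega> \<Longrightarrow> (LINT x:\<Omega>|lebesgue. w x * \<phi> x) = 0"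
  shows "AE x in lebesgue. x \<in> \<Omega> \<longrightarrow> w x = 0"
proof -
  have wm: "w \<in> borel_measurable lebesgue" using w by (simp add: square_integrable_def)
  have box0: "(LINT x:box a b|lebesgue. w x) = 0" if ab: "cbox a b \<subseteq> \<Omega>" for a b
  proof -
    have test: "cutoff a b k \<in> test_functions \<Omega>" for k using ab by (rule cutoff_test_function)
    have cm: "cutoff a b k \<in> borel_measurable lebesgue" for k
    proof -
      have "continuous_on UNIV (cutoff a b k)"
        using test[of k] unfolding test_functions_def by (metis (mono_tags) cont_diff.simps(1) mem_Collect_eq)
      then show ?thesis
        by (intro measurable_completion) (simp add: borel_measurable_continuous_onI)
    qed
    have "(\<lambda>k. LINT x|lebesgue. w x * cutoff a b k x) \<longlonglongrightarrow> (LINT x|lebesgue. w x * indicator (box a b) x)"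
    proof (rule integral_dominated_convergence)
      show "integrable lebesgue (\<lambda>x. \<bar>indicator (cbox a b) x * w x\<bar>)"
        using square_integrable_imp_integrable_on_cbox[OF w] by (rule integrable_abs)
      show "AE x in lebesgue. (\<lambda>k. w x * cutoff a b k x) \<longlonglongrightarrow> w x * indicator (box a b) x"
        by (intro AE_I2 tendsto_mult tendsto_const cutoff_tendsto)
      show "AE x in lebesgue. norm (w x * cutoff a b k x) \<le> \<bar>indicator (cbox a b) x * w x\<bar>" for k
      proof (intro AE_I2)
        fix x
        show "norm (w x * cutoff a b k x) \<le> \<bar>indicator (cbox a b) x * w x\<bar>"
        proof (cases "x \<in> box a b")
          case True
          then have "x \<in> cbox a b" using box_subset_cbox by blast
          then show ?thesis
            using cutoff_range[of a b k x] by (simp add: abs_mult mult_left_le)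
        qed (simp add: cutoff_eq_0)
      qed
    qed (use wm cm in \<open>auto intro!: borel_measurable_times borel_measurable_indicator\<close>)
    moreover have "(LINT x|lebesgue. w x * cutoff a b k x) = 0" for k
    proof -
      have "(LINT x|lebesgue. w x * cutoff a b k x) = (LINT x:\<Omega>|lebesgue. w x * cutoff a b k x)"
        unfolding set_lebesgue_integral_def
        by (rule Bochner_Integration.integral_cong[OF refl])
          (use ab box_subset_cbox[of a b] cutoff_eq_0[of _ a b k] in \<open>force simp: indicator_def\<close>)
      then show ?thesis using zero[OF test] by simp
    qed
    ultimately show ?thesis
      by (simp add: LIMSEQ_const_iff set_lebesgue_integral_def mult.commute)
  qed
  have ae_box: "AE x in lebesgue. x \<in> box a b \<longrightarrow> w x = 0" if ab: "cbox a b \<subseteq> \<Omega>" for a b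
  proof -
    have "AE x in lebesgue. indicator (box a b) x * w x = 0"
    proof (rule AE_zero_if_box_integrals_zero)
      have "integrable lebesgue (\<lambda>x. indicator (box a b) x *\<^sub>R (indicator (cbox a b) x * w x))"
        by (intro integrable_mult_indicator square_integrable_imp_integrable_on_cbox w) auto
      moreover have "(\<lambda>x. indicator (box a b) x *\<^sub>R (indicator (cbox a b) x * w x))
          = (\<lambda>x. indicator (box a b) x * w x)"
        using box_subset_cbox[of a b] by (fastforce simp: indicator_def)
      ultimately show "integrable lebesgue (\<lambda>x. indicator (box a b) x * w x)" by simp
      fix c d
      \<comment> \<open>A box inside \<open>box a b\<close> is again admissible, as its closure lies in \<open>cbox a b\<close>.\<close>
      obtain e f where ef: "box c d \<inter> box a b = box e f" using box_Int_box by blast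
      show "(LINT x:box c d|lebesgue. indicator (box a b) x * w x) = 0"
      proof (cases "box e f = {}")
        case True
        then show ?thesis using ef by (simp add: set_lebesgue_integral_def flip: indicator_inter_arith mult.assoc)
      next
        case False
        have "cbox e f \<subseteq> cbox a b"
          using ef False closure_mono[of "box e f" "box a b"]
          by (metis closure_box closure_empty inf_le2 subset_empty)
        then have "(LINT x:box e f|lebesgue. w x) = 0" using ab by (intro box0) auto
        then show ?thesis by (simp add: set_lebesgue_integral_def indicator_inter_arith mult.assoc flip: ef)
      qed
    qed
    then show ?thesis by (auto simp: indicator_def elim: eventually_mono)
  qed
  \<comment> \<open>The cover consists of closed boxes, whose boundaries are null sets.\<close>
  obtain D where D: "countable D" "D \<subseteq> Pow \<Omega>" "\<And>X. X \<in> D \<Longrightarrow> \<exists>a b. X = cbox a b" "\<Union>D = \<Omega>"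
    using open_countable_Union_open_cbox[OF \<open>open \<Omega>\<close>] by metis
  have "AE x in lebesgue. x \<in> X \<longrightarrow> w x = 0" if "X \<in> D" for X
  proof -
    obtain a b where X: "X = cbox a b" using D(3)[OF \<open>X \<in> D\<close>] by blast
    have "AE x in lebesgue. x \<notin> cbox a b - box a b"
      using negligible_frontier_interval[of a b] by (intro AE_not_in) (simp add: negligible_iff_null_sets)
    moreover have "AE x in lebesgue. x \<in> box a b \<longrightarrow> w x = 0"
      by (rule ae_box) (use X that D(2) in auto)
    ultimately show ?thesis unfolding X by eventually_elim auto
  qed
  then have "AE x in lebesgue. \<forall>X\<in>D. x \<in> X \<longrightarrow> w x = 0"
    by (intro AE_ball_countable[OF D(1), THEN iffD2] ballI)
  then show ?thesis using D(4) by (auto elim: eventually_mono)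
qed

section \<open>Uniqueness and linearity of weak derivatives\<close>

lemma L2_rel_rep: "L2_rel (rep_L2 u) (rep_L2 u)"
  using Quotient3_rep_reflp[OF Quotient3_L2] .

lemma square_integrable_rep: "square_integrable (rep_L2 u)"
  using L2_rel_rep[of u] by (simp add: L2_rel_def)

lemma rep_abs_AE: "square_integrable f \<Longrightarrow> AE x in lebesgue. rep_L2 (abs_L2 f) x = f x"
  using rep_abs_rsp_left[OF Quotient3_L2, of f f] by (simp add: L2_rel_def)

lemma L2_eqI: "(AE x in lebesgue. rep_L2 u x = rep_L2 v x) \<Longrightarrow> u = v"
  using Quotient3_rel_rep[OF Quotient3_L2, of u v] square_integrable_rep by (auto simp: L2_rel_def)

lemma rep_zero_AE: "AE x in lebesgue. rep_L2 0 x = 0"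
  unfolding zero_L2_def by (rule rep_abs_AE[OF square_integrable_zero])

text \<open>Closure properties and linearity are stated for combinations \<open>c u + v\<close> throughout, so that
  additivity and homogeneity never have to be treated separately.\<close>

lemma rep_linear_AE:
  "AE x in lebesgue. rep_L2 (c *\<^sub>R u + v) x = c *\<^sub>R rep_L2 u x + rep_L2 v x"
proof -
  have "AE x in lebesgue. rep_L2 (c *\<^sub>R u + v) x = rep_L2 (c *\<^sub>R u) x + rep_L2 v x"
    unfolding plus_L2_def map_fun_apply
    by (intro rep_abs_AE square_integrable_add square_integrable_rep)
  moreover have "AE x in lebesgue. rep_L2 (c *\<^sub>R u) x = c *\<^sub>R rep_L2 u x"
    unfolding scaleR_L2_def map_fun_apply id_apply
    by (intro rep_abs_AE square_integrable_scaleR square_integrable_rep)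
  ultimately show ?thesis by eventually_elim simp
qed

lemma L2_on_linear: "u \<in> L2_on \<Omega> \<Longrightarrow> v \<in> L2_on \<Omega> \<Longrightarrow> c *\<^sub>R u + v \<in> L2_on \<Omega>"
  unfolding L2_on_def mem_Collect_eq
proof -
  assume "AE x in lebesgue. x \<notin> \<Omega> \<longrightarrow> rep_L2 u x = 0" "AE x in lebesgue. x \<notin> \<Omega> \<longrightarrow> rep_L2 v x = 0"
  with rep_linear_AE[of c u v] show "AE x in lebesgue. x \<notin> \<Omega> \<longrightarrow> rep_L2 (c *\<^sub>R u + v) x = 0"
    by eventually_elim simp
qed

lemma square_integrable_compact_support:
  fixes \<psi> :: "'a::euclidean_space \<Rightarrow> real"
  assumes "continuous_on UNIV \<psi>" "compact K" "\<And>x. x \<notin> K \<Longrightarrow> \<psi> x = 0"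
  shows "square_integrable \<psi>"
  unfolding square_integrable_def
proof
  show "\<psi> \<in> borel_measurable lebesgue"
    using assms(1) by (intro measurable_completion) (simp add: borel_measurable_continuous_onI)
  have "integrable lborel (\<lambda>x. indicator K x *\<^sub>R (\<psi> x)\<^sup>2)"
    using assms by (intro borel_integrable_compact continuous_intros)
      (auto intro: continuous_on_subset)
  then have "integrable lebesgue (\<lambda>x. indicator K x *\<^sub>R (\<psi> x)\<^sup>2)"
    by (simp add: integrable_completion borel_measurable_integrable)
  moreover have "(\<lambda>x. indicator K x *\<^sub>R (\<psi> x)\<^sup>2) = (\<lambda>x. (norm (\<psi> x))\<^sup>2)"
    using assms(3) by (force simp: indicator_def)
  ultimately show "integrable lebesgue (\<lambda>x. (norm (\<psi> x))\<^sup>2)" by simp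
qed

lemma square_integrable_test_function:
  assumes "\<phi> \<in> test_functions \<Omega>"
  shows "square_integrable \<phi>" "square_integrable (partial_deriv j \<phi>)"
proof -
  let ?K = "closure {x. \<phi> x \<noteq> 0}"
  have smooth: "\<And>k. cont_diff k \<phi>" and K: "compact ?K"
    using assms by (auto simp: test_functions_def)
  have outside: "\<phi> x = 0" if "x \<notin> ?K" for x
    using that subsetD[OF closure_subset, of x "{x. \<phi> x \<noteq> 0}"] by auto
  show "square_integrable \<phi>"
    by (rule square_integrable_compact_support[OF smooth[of 0, unfolded cont_diff.simps] K outside])
  have "partial_deriv j \<phi> x = 0" if "x \<notin> ?K" for x
  proof -
    have "(\<phi> has_derivative (\<lambda>_. 0)) (at x)"
    proof (rule has_derivative_transform_within_open[where s = "- ?K" and f = "\<lambda>_. 0"])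
      show "0 = \<phi> y" if "y \<in> - ?K" for y
        using outside[of y] that by (simp del: closure_complement)
      show "open (- ?K)" by (rule open_Compl[OF closed_closure])
      show "x \<in> - ?K" using that by (simp only: Compl_iff not_False_eq_True)
    qed (rule has_derivative_const)
    from partial_deriv_eq[OF this] show ?thesis .
  qed
  moreover have "continuous_on UNIV (partial_deriv j \<phi>)"
    using smooth[of "Suc 0"] unfolding cont_diff.simps by blast
  ultimately show "square_integrable (partial_deriv j \<phi>)"
    by (intro square_integrable_compact_support[OF _ K])
qed

lemma set_integrable_square_integrable_mult:
  fixes f g :: "'a::euclidean_space \<Rightarrow> real"
  assumes "open \<Omega>" "square_integrable f" "square_integrable g"
  shows "set_integrable lebesgue \<Omega> (\<lambda>x. f x * g x)"
  unfolding set_integrable_def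
  using square_integrable_inner[OF assms(2,3)] assms(1) by (intro integrable_mult_indicator) auto

lemma set_integral_rep_linear:
  fixes \<psi> :: "'a::euclidean_space \<Rightarrow> real"
  assumes \<Omega>: "open \<Omega>" and \<psi>: "square_integrable \<psi>"
  shows "(LINT x:\<Omega>|lebesgue. rep_L2 (c *\<^sub>R u + v) x * \<psi> x) =
    c * (LINT x:\<Omega>|lebesgue. rep_L2 u x * \<psi> x) + (LINT x:\<Omega>|lebesgue. rep_L2 v x * \<psi> x)"
proof -
  note int = set_integrable_square_integrable_mult[OF \<Omega> square_integrable_rep \<psi>]
  have "(LINT x:\<Omega>|lebesgue. rep_L2 (c *\<^sub>R u + v) x * \<psi> x) =
      (LINT x:\<Omega>|lebesgue. c * (rep_L2 u x * \<psi> x) + rep_L2 v x * \<psi> x)"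
    using \<Omega> \<psi> square_integrable_rep rep_linear_AE[of c u v]
    unfolding set_lebesgue_integral_def square_integrable_def
    by (intro integral_cong_AE borel_measurable_scaleR borel_measurable_indicator
        borel_measurable_times borel_measurable_add borel_measurable_const)
      (auto elim!: eventually_mono simp: algebra_simps)
  also have "\<dots> = c * (LINT x:\<Omega>|lebesgue. rep_L2 u x * \<psi> x) + (LINT x:\<Omega>|lebesgue. rep_L2 v x * \<psi> x)"
    using int by (simp add: set_integral_add)
  finally show ?thesis .
qed

lemma is_weak_pderiv_linear:
  assumes \<Omega>: "open \<Omega>" and "is_weak_pderiv \<Omega> j u w" "is_weak_pderiv \<Omega> j v z"
  shows "is_weak_pderiv \<Omega> j (c *\<^sub>R u + v) (c *\<^sub>R w + z)"
  unfolding is_weak_pderiv_def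
proof (intro conjI ballI)
  show "c *\<^sub>R w + z \<in> L2_on \<Omega>"
    using assms(2,3) by (auto simp: is_weak_pderiv_def intro: L2_on_linear)
  fix \<phi> assume \<phi>: "\<phi> \<in> test_functions \<Omega>"
  have "(LINT x:\<Omega>|lebesgue. rep_L2 u x * partial_deriv j \<phi> x) = - (LINT x:\<Omega>|lebesgue. rep_L2 w x * \<phi> x)"
    "(LINT x:\<Omega>|lebesgue. rep_L2 v x * partial_deriv j \<phi> x) = - (LINT x:\<Omega>|lebesgue. rep_L2 z x * \<phi> x)"
    using assms(2,3) \<phi> by (auto simp: is_weak_pderiv_def)
  then show "(LINT x:\<Omega>|lebesgue. rep_L2 (c *\<^sub>R u + v) x * partial_deriv j \<phi> x) =
      - (LINT x:\<Omega>|lebesgue. rep_L2 (c *\<^sub>R w + z) x * \<phi> x)"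
    unfolding set_integral_rep_linear[OF \<Omega> square_integrable_test_function(1)[OF \<phi>]]
      set_integral_rep_linear[OF \<Omega> square_integrable_test_function(2)[OF \<phi>]] by simp
qed

text \<open>The difference of two weak derivatives of \<open>u\<close> is a weak derivative of \<open>0\<close>, so it is orthogonal
  to all test functions. The fundamental lemma makes it vanish inside \<open>\<Omega>\<close>, membership in
  \<open>L2_on \<Omega>\<close> outside.\<close>

lemma is_weak_pderiv_unique:
  assumes \<Omega>: "open \<Omega>" and w: "is_weak_pderiv \<Omega> j u w" and z: "is_weak_pderiv \<Omega> j u z"
  shows "w = z"
proof -
  let ?d = "(- 1) *\<^sub>R z + w"
  have d: "is_weak_pderiv \<Omega> j 0 ?d"
    using is_weak_pderiv_linear[OF \<Omega> z w, of "- 1"] by simp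
  have "(LINT x:\<Omega>|lebesgue. rep_L2 ?d x * \<phi> x) = 0" if "\<phi> \<in> test_functions \<Omega>" for \<phi>
  proof -
    have "(LINT x:\<Omega>|lebesgue. rep_L2 0 x * partial_deriv j \<phi> x) = 0"
      using set_integral_rep_linear[OF \<Omega> square_integrable_test_function(2)[OF that], of "- 1" 0 0 j] by simp
    then show ?thesis using d that by (simp add: is_weak_pderiv_def)
  qed
  then have "AE x in lebesgue. x \<in> \<Omega> \<longrightarrow> rep_L2 ?d x = 0"
    by (rule fundamental_lemma_calculus_of_variations[OF \<Omega> square_integrable_rep])
  moreover have "AE x in lebesgue. x \<notin> \<Omega> \<longrightarrow> rep_L2 ?d x = 0"
    using d by (simp add: is_weak_pderiv_def L2_on_def)
  ultimately have "AE x in lebesgue. rep_L2 ?d x = rep_L2 0 x"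
    using rep_zero_AE by eventually_elim auto
  then have "?d = 0" by (rule L2_eqI)
  then show ?thesis by simp
qed

lemma weak_pderiv_eq: "open \<Omega> \<Longrightarrow> is_weak_pderiv \<Omega> j u w \<Longrightarrow> weak_pderiv \<Omega> j u = w"
  unfolding weak_pderiv_def by (blast intro: the_equality is_weak_pderiv_unique)

lemma weak_pderiv_linear:
  assumes \<Omega>: "open \<Omega>" and u: "u \<in> H1 \<Omega>" and v: "v \<in> H1 \<Omega>"
  shows "weak_pderiv \<Omega> j (c *\<^sub>R u + v) = c *\<^sub>R weak_pderiv \<Omega> j u + weak_pderiv \<Omega> j v"
proof -
  obtain w z where "is_weak_pderiv \<Omega> j u w" "is_weak_pderiv \<Omega> j v z"
    using u v unfolding H1_def by blast
  then show ?thesis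
    using weak_pderiv_eq[OF \<Omega>] is_weak_pderiv_linear[OF \<Omega>] by metis
qed

lemma L2_nth_linear: "L2_nth (c *\<^sub>R u + v) i = c *\<^sub>R L2_nth u i + L2_nth v i"
  by transfer (auto simp: L2_rel_def
      intro!: square_integrable_add square_integrable_scaleR square_integrable_nth)

lemma L2_vec_linear: "L2_vec (\<lambda>i. c *\<^sub>R F i + G i) = c *\<^sub>R L2_vec F + L2_vec G"
  by transfer (auto simp: L2_rel_def vec_eq_iff
      intro!: square_integrable_add square_integrable_scaleR square_integrable_vec)

lemma grad_linear:
  "open \<Omega> \<Longrightarrow> u \<in> H1 \<Omega> \<Longrightarrow> v \<in> H1 \<Omega> \<Longrightarrow> grad \<Omega> (c *\<^sub>R u + v) = c *\<^sub>R grad \<Omega> u + grad \<Omega> v"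
  by (simp add: grad_def weak_pderiv_linear L2_vec_linear)

lemma
  assumes "open \<Omega>" "u \<in> V_space \<Omega>" "v \<in> V_space \<Omega>"
  shows Grad_linear: "Grad \<Omega> (c *\<^sub>R u + v) = c *\<^sub>R Grad \<Omega> u + Grad \<Omega> v"
    and Div_linear: "Div \<Omega> (c *\<^sub>R u + v) = c *\<^sub>R Div \<Omega> u + Div \<Omega> v"
proof -
  have H1: "L2_nth u i \<in> H1 \<Omega>" "L2_nth v i \<in> H1 \<Omega>" for i
    using assms by (auto simp: V_space_def H10_def)
  show "Grad \<Omega> (c *\<^sub>R u + v) = c *\<^sub>R Grad \<Omega> u + Grad \<Omega> v"
    by (simp add: Grad_def L2_nth_linear grad_linear assms(1) H1 L2_vec_linear)
  show "Div \<Omega> (c *\<^sub>R u + v) = c *\<^sub>R Div \<Omega> u + Div \<Omega> v"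
    by (simp add: Div_def L2_nth_linear weak_pderiv_linear assms(1) H1 sum.distrib scaleR_sum_right)
qed

section \<open>Riesz representation in finite dimensions\<close>

text \<open>The operators of the discrete problem are determined only on the finite element spaces, so
  linearity has to be relative to a subspace.\<close>

definition linear_on :: "'v::real_vector set \<Rightarrow> ('v \<Rightarrow> 'w::real_vector) \<Rightarrow> bool" where
  "linear_on S F \<longleftrightarrow> (\<forall>x\<in>S. \<forall>y\<in>S. \<forall>c. F (c *\<^sub>R x + y) = c *\<^sub>R F x + F y)"

lemma linear_onD: "linear_on S F \<Longrightarrow> x \<in> S \<Longrightarrow> y \<in> S \<Longrightarrow> F (c *\<^sub>R x + y) = c *\<^sub>R F x + F y"
  by (simp add: linear_on_def)

lemma linear_on_diff:
  "linear_on S F \<Longrightarrow> x \<in> S \<Longrightarrow> y \<in> S \<Longrightarrow> F (x - y) = F x - F y"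
  using linear_onD[of S F y x "- 1"] by simp

lemma linear_on_subset: "linear_on S F \<Longrightarrow> R \<subseteq> S \<Longrightarrow> linear_on R F"
  by (auto simp: linear_on_def)

lemma subspace_linear: "subspace S \<Longrightarrow> x \<in> S \<Longrightarrow> y \<in> S \<Longrightarrow> c *\<^sub>R x + y \<in> S"
  by (simp add: subspace_add subspace_scale)

lemma subspace_image_linear_on:
  assumes S: "subspace S" and F: "linear_on S F"
  shows "subspace (F ` S)"
proof (rule subspaceI)
  have 0: "0 \<in> S" using S by (rule subspace_0)
  have F0: "F 0 = 0" using linear_on_diff[OF F 0 0] by simp
  then show "0 \<in> F ` S" using 0 by (metis imageI)
  fix x y c assume "x \<in> F ` S" "y \<in> F ` S"
  then obtain x' y' where "x' \<in> S" "y' \<in> S" "x = F x'" "y = F y'" by blast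
  then have "x + y = F (1 *\<^sub>R x' + y')" "c *\<^sub>R x = F (c *\<^sub>R x' + 0)"
    "1 *\<^sub>R x' + y' \<in> S" "c *\<^sub>R x' + 0 \<in> S"
    using linear_onD[OF F, of x' y' 1] linear_onD[OF F, of x' 0 c] 0 F0
      subspace_linear[OF S, of x' y' 1] subspace_linear[OF S, of x' 0 c] by auto
  then show "x + y \<in> F ` S" "c *\<^sub>R x \<in> F ` S" by blast+
qed

text \<open>A maximal independent subset of \<open>R\<close> cannot be larger than a finite spanning set of \<open>S\<close>.\<close>

lemma finite_dim_subspace_mono:
  assumes R: "subspace R" and "R \<subseteq> S" and S: "finite_dim_subspace S"
  shows "finite_dim_subspace R"
proof -
  obtain B where "finite B" "S = span B" using S by (auto simp: finite_dim_subspace_def)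
  moreover obtain A where A: "A \<subseteq> R" "independent A" "R \<subseteq> span A"
    using maximal_independent_subset by blast
  ultimately have "finite A"
    using independent_span_bound[of B A] \<open>R \<subseteq> S\<close> by auto
  moreover have "R = span A" using A R by (simp add: span_minimal subset_antisym)
  ultimately show ?thesis using R by (auto simp: finite_dim_subspace_def)
qed

text \<open>The representation theorem is proved for an arbitrary inner product \<open>a\<close> on \<open>S\<close>, because it is
  needed both for the \<open>L\<^sup>2\<close> product, which defines the discrete operators, and for the energy
  product, which yields the velocity.

  Existence is a Gram-Schmidt step for each vector \<open>b\<close> of a spanning set: the projection \<open>p\<close>
  of \<open>b\<close> to the span of the previous vectors is itself the representer of \<open>a b\<close>, and the
  representer of \<open>F\<close> is corrected by a multiple of \<open>e = b - p\<close>.\<close>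

theorem riesz_finite_dim:
  fixes a :: "'v::real_vector \<Rightarrow> 'v \<Rightarrow> real"
  assumes S: "finite_dim_subspace S"
    and lin: "\<And>z. z \<in> S \<Longrightarrow> linear_on S (\<lambda>x. a x z)"
    and sym: "\<And>x y. x \<in> S \<Longrightarrow> y \<in> S \<Longrightarrow> a x y = a y x"
    and pos: "\<And>x. x \<in> S \<Longrightarrow> x \<noteq> 0 \<Longrightarrow> 0 < a x x"
    and F: "linear_on S F"
  shows "\<exists>!w. w \<in> S \<and> (\<forall>v\<in>S. a w v = F v)"
proof -
  have sub: "subspace S" using S by (simp add: finite_dim_subspace_def)
  note comb = subspace_linear[OF sub]
  have aD: "a (c *\<^sub>R x + y) z = c * a x z + a y z" if "x \<in> S" "y \<in> S" "z \<in> S" for c x y z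
    using linear_onD[OF lin] that by simp
  have aD': "a z (c *\<^sub>R x + y) = c * a z x + a z y" if "x \<in> S" "y \<in> S" "z \<in> S" for c x y z
    using aD[OF that] sym[OF \<open>z \<in> S\<close>] comb that by simp
  have ex: "\<exists>w\<in>span B. \<forall>v\<in>span B. a w v = F v" if "finite B" "B \<subseteq> S" "linear_on S F" for B F
    using that
  proof (induction B arbitrary: F rule: finite_induct)
    case empty
    have "a 0 0 = 0" "F 0 = 0"
      using linear_on_diff[OF lin[of 0], of 0 0] linear_on_diff[OF empty(2), of 0 0]
        subspace_0[OF sub] by auto
    then show ?case by simp
  next
    case (insert b B)
    have bS: "b \<in> S" and BS: "span B \<subseteq> S"
      using insert.prems sub by (auto intro: span_minimal[THEN subsetD])
    have "linear_on S (a b)" using aD' bS by (simp add: linear_on_def)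
    then obtain p where p: "p \<in> span B" "\<And>v. v \<in> span B \<Longrightarrow> a p v = a b v"
      using insert.IH[of "a b"] insert.prems by auto
    obtain w0 where w0: "w0 \<in> span B" "\<And>v. v \<in> span B \<Longrightarrow> a w0 v = F v"
      using insert.IH[of F] insert.prems by auto
    define e where "e = (- 1) *\<^sub>R p + b"
    have eS: "e \<in> S" and pS: "p \<in> S" and w0S: "w0 \<in> S"
      using subspace_diff[OF sub, of b p] bS BS p(1) w0(1) by (auto simp: e_def)
    have orth: "a e v = 0" if "v \<in> span B" for v
      using aD[OF pS bS, of v "- 1"] p(2) that BS by (auto simp: e_def)
    show ?case
    proof (cases "e = 0")
      case True
      then have "b \<in> span B" using p(1) by (simp add: e_def)
      then show ?thesis using w0 by (auto simp: span_redundant)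
    next
      case False
      let ?k = "F e / a e e"
      let ?w = "?k *\<^sub>R e + w0"
      have aee: "0 < a e e" using pos eS False by simp
      have "?w \<in> span (insert b B)"
        using subsetD[OF span_mono[of B "insert b B"]] w0(1) p(1) span_base[of b "insert b B"]
        unfolding e_def by (intro span_add span_scale) (auto intro: span_diff)
      moreover have "a ?w v = F v" if "v \<in> span (insert b B)" for v
      proof -
        from that obtain m where m: "v - m *\<^sub>R b \<in> span B" by (auto simp: span_breakdown_eq)
        define v' where "v' = m *\<^sub>R p + (v - m *\<^sub>R b)"
        have v': "v' \<in> span B" unfolding v'_def using m p(1) by (intro span_add span_scale)
        then have v'S: "v' \<in> S" using BS by auto
        have v: "v = m *\<^sub>R e + v'" by (simp add: v'_def e_def algebra_simps)
        have "a ?w v = ?k * (m * a e e + a e v') + (m * a w0 e + a w0 v')"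
          unfolding v using aD[OF eS w0S comb[OF eS v'S]] aD'[OF eS v'S] eS w0S by simp
        also have "a w0 e = 0" using orth[OF w0(1)] sym eS w0S by simp
        also have "a e v' = 0" using orth[OF v'] .
        finally have "a ?w v = m * F e + F v'" using aee w0(2)[OF v'] by simp
        also have "\<dots> = F v" unfolding v using linear_onD[OF insert.prems(2) eS v'S] by simp
        finally show ?thesis .
      qed
      ultimately show ?thesis by blast
    qed
  qed
  obtain B where B: "finite B" "S = span B" using S by (auto simp: finite_dim_subspace_def)
  then obtain w where w: "w \<in> S" "\<forall>v\<in>S. a w v = F v"
    using ex[of B F] F span_superset[of B] by auto
  moreover have "z = w" if z: "z \<in> S" "\<forall>v\<in>S. a z v = F v" for z
  proof (rule ccontr)
    assume "z \<noteq> w"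
    then have "0 < a (z - w) (z - w)" using z w sub by (intro pos) (auto simp: subspace_diff)
    moreover have "a (z - w) (z - w) = a z (z - w) - a w (z - w)"
      using z w sub by (intro linear_on_diff[OF lin]) (auto simp: subspace_diff)
    ultimately show False using z w sub by (simp add: subspace_diff)
  qed
  ultimately show ?thesis by blast
qed

lemma riesz_inner:
  fixes S :: "'v::real_inner set"
  assumes "finite_dim_subspace S" "linear_on S F"
  shows "\<exists>!w. w \<in> S \<and> (\<forall>v\<in>S. inner w v = F v)"
  using assms
  by (intro riesz_finite_dim) (auto simp: linear_on_def inner_add_left intro: inner_commute)

section \<open>The discrete saddle point problem\<close>

text \<open>The condition \<open>div_faithful\<close> is injectivity of the discrete gradient, the qualitative content of
  the inf-sup condition on fixed finite-dimensional spaces.\<close>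

locale discrete_stokes =
  fixes \<Omega> :: "(real ^ 'd::finite) set"
    and Vh :: "(real ^ 'd, real ^ 'd) L2 set"
    and Qh :: "(real ^ 'd, real) L2 set"
  assumes open_domain: "open \<Omega>"
    and Vh: "finite_dim_subspace Vh" and Vh_V: "Vh \<subseteq> V_space \<Omega>"
    and Qh: "finite_dim_subspace Qh"
    and div_faithful: "\<And>q. q \<in> Qh \<Longrightarrow> (\<And>v. v \<in> Vh \<Longrightarrow> inner (Div \<Omega> v) q = 0) \<Longrightarrow> q = 0"
begin

abbreviation "A \<equiv> A_h \<Omega> Vh"
abbreviation "B \<equiv> B_h \<Omega> Qh"
abbreviation "B' \<equiv> B_h' \<Omega> Vh"

lemma subspace_Vh: "subspace Vh" and subspace_Qh: "subspace Qh"
  using Vh Qh by (auto simp: finite_dim_subspace_def)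

lemmas Vh_linear = subspace_linear[OF subspace_Vh]

lemma linear_on_Grad: "linear_on Vh (Grad \<Omega>)" and linear_on_Div: "linear_on Vh (Div \<Omega>)"
  using Vh_V open_domain by (auto simp: linear_on_def Grad_linear Div_linear subset_iff)

lemmas Grad_comb = linear_onD[OF linear_on_Grad] and Div_comb = linear_onD[OF linear_on_Div]

lemma A_inner:
  assumes "u \<in> Vh" "v \<in> Vh"
  shows "inner (A u) v = inner (Grad \<Omega> u) (Grad \<Omega> v)"
proof -
  have "linear_on Vh (\<lambda>v. inner (Grad \<Omega> u) (Grad \<Omega> v))"
    by (simp add: linear_on_def Grad_comb inner_add_right)
  from theI'[OF riesz_inner[OF Vh this]] show ?thesis
    using assms by (simp add: A_h_def)
qed

lemma B_inner:
  assumes "q \<in> Qh"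
  shows "inner (B v) q = - inner (Div \<Omega> v) q"
proof -
  have "linear_on Qh (\<lambda>q. - inner (Div \<Omega> v) q)"
    by (simp add: linear_on_def inner_add_right)
  from theI'[OF riesz_inner[OF Qh this]] show ?thesis
    using assms by (simp add: B_h_def)
qed

lemma B'_in: "B' q \<in> Vh" and B'_inner: "v \<in> Vh \<Longrightarrow> inner (B' q) v = - inner (Div \<Omega> v) q"
proof -
  have "linear_on Vh (\<lambda>v. - inner (Div \<Omega> v) q)"
    by (simp add: linear_on_def Div_comb inner_add_left)
  from theI'[OF riesz_inner[OF Vh this]]
  show "B' q \<in> Vh" "v \<in> Vh \<Longrightarrow> inner (B' q) v = - inner (Div \<Omega> v) q"
    by (auto simp: B_h'_def)
qed

lemma inner_A_linear:
  "u \<in> Vh \<Longrightarrow> w \<in> Vh \<Longrightarrow> v \<in> Vh \<Longrightarrow> inner (A (c *\<^sub>R u + w)) v = c * inner (A u) v + inner (A w) v"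
  by (simp add: A_inner Vh_linear Grad_comb inner_add_left)

lemma inner_B_linear:
  "u \<in> Vh \<Longrightarrow> w \<in> Vh \<Longrightarrow> q \<in> Qh \<Longrightarrow> inner (B (c *\<^sub>R u + w)) q = c * inner (B u) q + inner (B w) q"
  by (simp add: B_inner Div_comb inner_add_left)

lemma inner_B'_linear:
  "v \<in> Vh \<Longrightarrow> inner (B' (c *\<^sub>R p + q)) v = c * inner (B' p) v + inner (B' q) v"
  by (simp add: B'_inner inner_add_right algebra_simps)

text \<open>As a Riesz representative in \<open>Vh\<close>, \<open>B' q\<close> is determined by its products with \<open>Vh\<close>; testing the
  linearity defect against itself shows that it is zero.\<close>

lemma B'_linear: "linear_on Qh B'"
  unfolding linear_on_def
proof (intro ballI allI)
  fix p q c
  let ?d = "B' (c *\<^sub>R p + q) - (c *\<^sub>R B' p + B' q)"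
  have "?d \<in> Vh" by (intro subspace_diff[OF subspace_Vh] Vh_linear B'_in)
  then have "inner ?d ?d = 0" by (simp add: inner_diff_left inner_add_left inner_B'_linear)
  then show "B' (c *\<^sub>R p + q) = c *\<^sub>R B' p + B' q" by simp
qed

lemma subspace_Vh_div: "subspace (Vh_div \<Omega> Vh Qh)"
proof (rule subspaceI)
  have 0: "Div \<Omega> 0 = 0"
    using linear_on_diff[OF linear_on_Div, of 0 0] subspace_0[OF subspace_Vh] by simp
  then show "0 \<in> Vh_div \<Omega> Vh Qh" by (simp add: Vh_div_def subspace_0[OF subspace_Vh])
  fix x y c assume "x \<in> Vh_div \<Omega> Vh Qh" "y \<in> Vh_div \<Omega> Vh Qh"
  then have "x \<in> Vh" "y \<in> Vh" "\<forall>q\<in>Qh. inner (Div \<Omega> x) q = 0" "\<forall>q\<in>Qh. inner (Div \<Omega> y) q = 0"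
    by (auto simp: Vh_div_def)
  then show "x + y \<in> Vh_div \<Omega> Vh Qh" "c *\<^sub>R x \<in> Vh_div \<Omega> Vh Qh"
    using Vh_linear[of x y 1] Vh_linear[of x 0 c] Div_comb[of x y 1] Div_comb[of x 0 c]
    by (simp_all add: Vh_div_def inner_add_left subspace_0[OF subspace_Vh] 0)
qed

text \<open>In finite dimensions the range of \<open>B'\<close> is closed, hence it is the whole orthogonal complement of
  its annihilator \<open>Vh_div\<close>. Concretely, the representer \<open>w\<close> of \<open>F\<close> is projected to the range;
  the remainder is orthogonal to the range, thus discretely divergence free, and so \<open>F\<close>
  vanishes on it, which makes it orthogonal to itself.\<close>

lemma pressure_exists:
  assumes F: "linear_on Vh F" and zero: "\<And>v. v \<in> Vh_div \<Omega> Vh Qh \<Longrightarrow> F v = 0"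
  obtains p where "p \<in> Qh" "\<And>v. v \<in> Vh \<Longrightarrow> inner (B' p) v = F v"
proof -
  obtain w where w: "w \<in> Vh" "\<And>v. v \<in> Vh \<Longrightarrow> inner w v = F v"
    using riesz_inner[OF Vh F] by blast
  have "subspace (B' ` Qh)" by (rule subspace_image_linear_on[OF subspace_Qh B'_linear])
  then have fin: "finite_dim_subspace (B' ` Qh)"
    by (rule finite_dim_subspace_mono[OF _ _ Vh]) (use B'_in in auto)
  have "linear_on (B' ` Qh) (inner w)" by (simp add: linear_on_def inner_add_right)
  then obtain p where p: "p \<in> Qh" "\<And>q. q \<in> Qh \<Longrightarrow> inner (B' p) (B' q) = inner w (B' q)"
    using riesz_inner[OF fin] by blast
  let ?e = "w - B' p"
  have e: "?e \<in> Vh" using w B'_in subspace_diff[OF subspace_Vh] by blast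
  have orth: "inner (B' q) ?e = 0" if "q \<in> Qh" for q
    using p(2)[OF that] by (simp add: inner_diff_right inner_commute)
  then have "?e \<in> Vh_div \<Omega> Vh Qh" using e by (simp add: Vh_div_def B'_inner)
  then have "inner w ?e = 0" using zero w(2)[OF e] by simp
  then have "inner ?e ?e = 0" using orth[OF p(1)] by (simp add: inner_diff_left)
  then have "w = B' p" by simp
  with that p w show thesis by metis
qed

text \<open>Tested with discretely divergence free functions, the equation loses its pressure term and
  becomes the Riesz problem for the energy product on \<open>Vh_div\<close>, which determines \<open>u\<close>. What then
  remains of the equation is a functional that annihilates \<open>Vh_div\<close>, hence is represented by a
  pressure; \<open>div_faithful\<close> makes the pressure unique.\<close>

theorem saddle_point_unique_solution:
  assumes k: "0 < k" and F: "linear_on Vh F"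
  shows "\<exists>!(u, p). u \<in> Vh \<and> p \<in> Qh \<and>
    (\<forall>v\<in>Vh. inner u v + k * inner (A u + B' p) v = F v) \<and> (\<forall>q\<in>Qh. inner (B u) q = 0)"
    (is "\<exists>!(u, p). ?sol u p")
proof -
  let ?D = "Vh_div \<Omega> Vh Qh"
  let ?a = "\<lambda>u v. inner u v + k * inner (Grad \<Omega> u) (Grad \<Omega> v)"
  have DV: "?D \<subseteq> Vh" by (auto simp: Vh_div_def)
  have D: "finite_dim_subspace ?D"
    using finite_dim_subspace_mono[OF subspace_Vh_div DV Vh] .
  have a_lin: "linear_on Vh (\<lambda>u. ?a u z)" for z
    by (simp add: linear_on_def Grad_comb inner_add_left distrib_left)
  have riesz: "\<exists>!u. u \<in> ?D \<and> (\<forall>v\<in>?D. ?a u v = F v)"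
  proof (rule riesz_finite_dim[OF D])
    show "linear_on ?D (\<lambda>u. ?a u z)" for z using a_lin DV by (rule linear_on_subset)
    show "linear_on ?D F" using F DV by (rule linear_on_subset)
    show "0 < ?a x x" if "x \<noteq> 0" for x
      using that k by (intro add_pos_nonneg) auto
  qed (simp add: inner_commute)
  have iff: "?sol u p \<longleftrightarrow> u \<in> ?D \<and> p \<in> Qh \<and> (\<forall>v\<in>Vh. ?a u v + k * inner (B' p) v = F v)" for u p
    by (auto simp: Vh_div_def B_inner A_inner inner_add_left algebra_simps)
  have on_D: "inner (B' p) v = 0" if "v \<in> ?D" "p \<in> Qh" for p v
    using that by (auto simp: Vh_div_def B'_inner)
  obtain u where u: "u \<in> ?D" "\<And>v. v \<in> ?D \<Longrightarrow> ?a u v = F v" using riesz by blast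
  have "linear_on Vh (\<lambda>v. (F v - ?a u v) / k)"
    using k by (simp add: linear_on_def linear_onD[OF F] Grad_comb inner_add_right
        diff_divide_distrib add_divide_distrib distrib_left right_diff_distrib)
  moreover have "(F v - ?a u v) / k = 0" if "v \<in> ?D" for v
    using u that by simp
  ultimately obtain p where p: "p \<in> Qh" "\<And>v. v \<in> Vh \<Longrightarrow> inner (B' p) v = (F v - ?a u v) / k"
    using pressure_exists by blast
  have sol: "?sol u p" unfolding iff using u p k by simp
  have uniq: "u' = u \<and> p' = p" if "?sol u' p'" for u' p'
  proof
    have s: "u' \<in> ?D" "p' \<in> Qh" "\<And>v. v \<in> Vh \<Longrightarrow> ?a u' v + k * inner (B' p') v = F v"
      using that unfolding iff by auto
    then have "\<forall>v\<in>?D. ?a u' v = F v" using on_D DV by force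
    then show u_eq: "u' = u" using riesz s(1) u by blast
    have "inner (B' p') v = inner (B' p) v" if "v \<in> Vh" for v
    proof -
      have "k * inner (B' p') v = F v - ?a u v" using s(3)[OF that] u_eq by simp
      also have "\<dots> = k * inner (B' p) v" using p(2)[OF that] k by simp
      finally show ?thesis using k by simp
    qed
    then have "p' - p = 0"
      using s(2) p(1) by (intro div_faithful subspace_diff[OF subspace_Qh])
        (auto simp: B'_inner inner_diff_right)
    then show "p' = p" by simp
  qed
  show ?thesis
  proof (rule ex1I[of _ "(u, p)"])
    show "case (u, p) of (u, p) \<Rightarrow> ?sol u p" unfolding case_prod_conv by (rule sol)
    fix z assume z_sol: "case z of (u, p) \<Rightarrow> ?sol u p"
    obtain u' p' where z: "z = (u', p')" by (cases z)
    have "?sol u' p'" using z_sol unfolding z case_prod_conv .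
    from uniq[OF this] show "z = (u, p)" unfolding z by simp
  qed
qed

end

text \<open>For a non-zero \<open>q\<close> orthogonal to all divergences every quotient in the supremum is \<open>0\<close>, so the
  supremum is at most \<open>0\<close> (it is \<open>-\<infinity>\<close> if \<open>Vh\<close> is trivial), contradicting \<open>0 < \<beta>\<close>.\<close>

lemma inf_sup_imp_div_faithful:
  assumes "inf_sup_condition \<Omega> Vh Qh \<beta>" "q \<in> Qh" "\<And>v. v \<in> Vh \<Longrightarrow> inner (Div \<Omega> v) q = 0"
  shows "q = 0"
proof (rule ccontr)
  assume "q \<noteq> 0"
  then have "(INF q\<in>Qh - {0}. SUP v\<in>Vh - {0}.
      ereal (- inner (Div \<Omega> v) q / (V_norm \<Omega> v * norm q)))
    \<le> (SUP v\<in>Vh - {0}. ereal (- inner (Div \<Omega> v) q / (V_norm \<Omega> v * norm q)))"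
    using assms(2) by (intro INF_lower) auto
  also have "\<dots> \<le> 0" using assms(3) by (intro SUP_least) (simp flip: zero_ereal_def)
  finally have "ereal \<beta> \<le> 0" and "0 < \<beta>"
    using assms(1) unfolding inf_sup_condition_def by (blast intro: order_trans)+
  then show False by simp
qed

section \<open>Affine functions of time on one interval\<close>

locale time_slab =
  fixes a b m :: real and \<phi>\<^sub>0 \<phi>\<^sub>1 :: "real \<Rightarrow> real"
  assumes less: "a < b" and m: "m = (a + b) / 2"
    and \<phi>\<^sub>0: "\<phi>\<^sub>0 \<in> poly_space 1 {a..b} UNIV" "\<phi>\<^sub>0 a = 1" "\<phi>\<^sub>0 m = 0"
    and \<phi>\<^sub>1: "\<phi>\<^sub>1 \<in> poly_space 1 {a..b} UNIV" "\<phi>\<^sub>1 a = 0" "\<phi>\<^sub>1 m = 1"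
begin

abbreviation "J \<equiv> {a<..b}"
abbreviation "nod \<equiv> nodal J \<phi>\<^sub>0 \<phi>\<^sub>1"

lemma m_bounds: "a < m" "m < b" and half: "m - a = (b - a) / 2"
  using less by (auto simp: m field_simps)

lemma basis_explicit:
  assumes \<phi>: "\<phi> \<in> poly_space 1 {a..b} UNIV" and s: "s \<in> {a..b}"
  shows "\<phi> s = \<phi> m + (s - m) / (m - a) * (\<phi> m - \<phi> a)"
proof -
  obtain c :: "nat \<Rightarrow> real" where "\<forall>s\<in>{a..b}. \<phi> s = (\<Sum>i\<le>1. s ^ i *\<^sub>R c i)"
    using \<phi> unfolding poly_space_def by blast
  then have c: "\<phi> s = c 0 + s * c 1" if "s \<in> {a..b}" for s
    using that by simp
  have "\<phi> s = c 0 + s * c 1" "\<phi> a = c 0 + a * c 1" "\<phi> m = c 0 + m * c 1"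
    using s less m_bounds by (intro c; simp)+
  then show ?thesis using m_bounds by (simp add: field_simps)
qed

text \<open>Expansion about the midpoint: it is the form in which integration over the interval removes the
  linear part.\<close>

lemma nodal_eq:
  assumes "s \<in> J"
  shows "nod x y s = ((s - m) / (m - a)) *\<^sub>R (y - x) + y"
proof -
  have "\<phi>\<^sub>0 s = - ((s - m) / (m - a))" "\<phi>\<^sub>1 s = (s - m) / (m - a) + 1"
    using basis_explicit[OF \<phi>\<^sub>0(1), of s] basis_explicit[OF \<phi>\<^sub>1(1), of s] \<phi>\<^sub>0(2,3) \<phi>\<^sub>1(2,3) assms
    by (auto simp: minus_divide_left)
  then show ?thesis
    using assms by (simp add: nodal_def scaleR_add_left scaleR_diff_right del: minus_divide_left minus_diff_eq)
qed

lemma nodal_at_mid: "nod x y m = y"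
  using nodal_eq[of m] m_bounds by simp

lemma nodal_has_vector_derivative:
  assumes "s \<in> J"
  shows "(nod x y has_vector_derivative (1 / (m - a)) *\<^sub>R (y - x)) (at s within J)"
proof (rule has_vector_derivative_transform[OF assms])
  show "((\<lambda>s. ((s - m) / (m - a)) *\<^sub>R (y - x) + y) has_vector_derivative (1 / (m - a)) *\<^sub>R (y - x))
      (at s within J)"
    using m_bounds by (auto intro!: derivative_eq_intros)
qed (simp add: nodal_eq)

lemma vector_derivative_nodal:
  assumes "s \<in> J"
  shows "vector_derivative (nod x y) (at s within J) = (1 / (m - a)) *\<^sub>R (y - x)"
proof (rule vector_derivative_within[OF _ nodal_has_vector_derivative[OF assms]])
  \<comment> \<open>The derivative is well defined also at the end point \<open>b\<close>, which is a limit point from the left.\<close>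
  have "at s within {a<..<s} \<noteq> bot" using assms by (simp add: at_within_eq_bot_iff closure_greaterThanLessThan)
  moreover have "at s within {a<..<s} \<le> at s within J" using assms by (intro at_le) auto
  ultimately show "at s within J \<noteq> bot" by (metis bot.extremum_uniqueI)
qed

lemma nodal_tendsto:
  fixes x y :: "'v::real_normed_vector"
  shows "(nod x y \<longlongrightarrow> x) (at_right a)"
proof -
  have "((\<lambda>s. ((s - m) / (m - a)) *\<^sub>R (y - x) + y) \<longlongrightarrow> ((a - m) / (m - a)) *\<^sub>R (y - x) + y) (at_right a)"
    by (intro tendsto_intros) (use m_bounds in auto)
  moreover have "(a - m) / (m - a) = - 1" using m_bounds by (simp add: field_simps)
  moreover have "eventually (\<lambda>s. ((s - m) / (m - a)) *\<^sub>R (y - x) + y = nod x y s) (at_right a)"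
    using less by (auto simp: eventually_at_right nodal_eq intro!: exI[of _ b])
  ultimately show ?thesis by (simp add: Lim_transform_eventually)
qed

lemma nodal_in_poly_space:
  assumes S: "subspace S" and "x \<in> S" "y \<in> S"
  shows "nod x y \<in> poly_space 1 J S"
proof -
  let ?r = "(1 / (m - a)) *\<^sub>R (y - x)"
  let ?c = "\<lambda>i::nat. if i = 0 then y - m *\<^sub>R ?r else ?r"
  have c_in: "\<forall>i\<le>1. ?c i \<in> S" using assms by (simp add: subspace_diff subspace_scale)
  have c_eq: "nod x y s = (\<Sum>i\<le>1. s ^ i *\<^sub>R ?c i)" if "s \<in> J" for s
  proof -
    have "(s - m) / (m - a) = s * (1 / (m - a)) - m * (1 / (m - a))"
      by (simp add: diff_divide_distrib)
    then have "nod x y s = (s * (1 / (m - a)) - m * (1 / (m - a))) *\<^sub>R (y - x) + y"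
      using nodal_eq[OF that] by metis
    also have "\<dots> = (y - m *\<^sub>R ?r) + s *\<^sub>R ?r"
      by (simp only: scaleR_diff_left scaleR_scaleR) simp
    finally show ?thesis by simp
  qed
  have ext: "nod x y \<in> extensional J" by (simp add: nodal_def)
  show ?thesis
    unfolding poly_space_def mem_Collect_eq
    by (intro conjI exI[of _ ?c] ballI ext c_in c_eq)
qed

text \<open>The coefficients are the values at \<open>a\<close> and \<open>m\<close> of the affine extension; \<open>a\<close> itself is not in \<open>J\<close>.\<close>

lemma poly_space_nodal:
  assumes S: "subspace S" and w: "w \<in> poly_space 1 J S"
  obtains x y where "x \<in> S" "y \<in> S" "w = nod x y"
proof -
  have ext: "w \<in> extensional J" using w by (simp add: poly_space_def)
  obtain c where cS: "\<forall>i\<le>1. c i \<in> S" and w_eq: "\<forall>s\<in>J. w s = (\<Sum>i\<le>1. s ^ i *\<^sub>R c i)"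
    using w unfolding poly_space_def by blast
  have c: "c 0 \<in> S" "c 1 \<in> S" "\<And>s. s \<in> J \<Longrightarrow> w s = c 0 + s *\<^sub>R c 1"
    using cS w_eq by simp_all
  let ?x = "c 0 + a *\<^sub>R c 1" and ?y = "c 0 + m *\<^sub>R c 1"
  have "w = nod ?x ?y"
  proof (rule extensionalityI[OF ext])
    show "nod ?x ?y \<in> extensional J" by (simp add: nodal_def)
    fix s assume s: "s \<in> J"
    have "?y - ?x = (m - a) *\<^sub>R c 1" by (simp add: algebra_simps)
    then have "nod ?x ?y s = (s - m) *\<^sub>R c 1 + ?y"
      using nodal_eq[OF s, of ?x ?y] m_bounds by simp
    then show "w s = nod ?x ?y s" using c(3)[OF s] by (simp add: algebra_simps)
  qed
  moreover have "?x \<in> S" "?y \<in> S" using c S by (auto intro: subspace_add subspace_scale)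
  ultimately show thesis using that by blast
qed

lemma constant_in_poly_space: "c \<in> S \<Longrightarrow> (\<lambda>s\<in>J. c) \<in> poly_space 0 J S"
  by (auto simp: poly_space_def intro!: exI[of _ "\<lambda>_. c"])

lemma all_constant_in_time:
  assumes "\<And>v. v b \<in> S \<Longrightarrow> (\<And>s. s \<in> J \<Longrightarrow> v s = v b) \<Longrightarrow> P v \<longleftrightarrow> R (v b)"
  shows "(\<forall>v\<in>poly_space 0 J S. P v) \<longleftrightarrow> (\<forall>c\<in>S. R c)"
proof (intro iffI ballI)
  fix c assume *: "\<forall>v\<in>poly_space 0 J S. P v" and c: "c \<in> S"
  have "P (\<lambda>s\<in>J. c)" using * constant_in_poly_space[OF c] by blast
  moreover have "P (\<lambda>s\<in>J. c) \<longleftrightarrow> R ((\<lambda>s\<in>J. c) b)"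
    by (rule assms) (use c less in simp_all)
  ultimately show "R c" using less by simp
next
  fix v assume *: "\<forall>c\<in>S. R c" and v: "v \<in> poly_space 0 J S"
  then obtain c where "c \<in> S" "\<And>s. s \<in> J \<Longrightarrow> v s = c" by (auto simp: poly_space_def)
  then have "v b \<in> S" "\<And>s. s \<in> J \<Longrightarrow> v s = v b" using less by auto
  then show "P v" using * assms[of v] by blast
qed

text \<open>The midpoint rule is exact for affine functions.\<close>

lemma integral_affine:
  fixes g :: "real \<Rightarrow> real"
  assumes g: "\<And>s. s \<in> J \<Longrightarrow> g s = (s - m) * \<beta> + \<alpha>"
  shows "(LBINT s:J. g s) = (b - a) * \<alpha>"
proof -
  let ?G = "\<lambda>s. (s - m)\<^sup>2 / 2 * \<beta> + s * \<alpha>"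
  have "(LBINT s:J. g s) = (LBINT s:J. (s - m) * \<beta> + \<alpha>)"
    using g by (intro set_lebesgue_integral_cong) auto
  also have "\<dots> = (LBINT s:{a..b}. (s - m) * \<beta> + \<alpha>)"
  proof (rule set_integral_cong_set)
    have "AE s in lborel. s \<noteq> a" by (rule AE_lborel_singleton)
    then show "AE s in lborel. (s \<in> {a..b}) = (s \<in> J)" by (rule eventually_mono) (use less in auto)
  qed (auto simp: set_borel_measurable_def)
  also have "\<dots> = (\<integral>s. ((s - m) * \<beta> + \<alpha>) * indicator {a..b} s \<partial>lborel)"
    by (simp add: set_lebesgue_integral_def mult.commute)
  also have "\<dots> = ?G b - ?G a"
    using less by (intro integral_FTC_Icc_real) (auto intro!: derivative_eq_intros continuous_intros)
  also have "\<dots> = (b - a) * \<alpha>"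
    by (simp add: m power2_eq_square field_simps)
  finally show ?thesis .
qed

end

section \<open>Reduction of the space-time problem to the space problem\<close>

locale stokes_slab = discrete_stokes \<Omega> Vh Qh + time_slab a b m \<phi>\<^sub>0 \<phi>\<^sub>1
  for \<Omega> :: "(real ^ 'd::finite) set" and Vh Qh a b m \<phi>\<^sub>0 \<phi>\<^sub>1 +
  fixes f :: "real \<Rightarrow> (real ^ 'd, real ^ 'd) L2" and u\<^sub>0 :: "(real ^ 'd, real ^ 'd) L2"
begin

abbreviation "S_sols \<equiv> S_solutions \<Omega> Vh Qh f a b u\<^sub>0"
abbreviation "ST_sols \<equiv> ST_solutions \<Omega> Vh Qh f a b u\<^sub>0"

lemma S_unique_solution: "\<exists>!z. z \<in> S_sols"
proof -
  let ?F = "\<lambda>v. inner u\<^sub>0 v + (b - a) / 4 * inner (f a + f b) v"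
  have "linear_on Vh (\<lambda>v. inner u\<^sub>0 v + k * inner (f a + f b) v)" for k
    by (simp add: linear_on_def inner_add_right distrib_left)
  then have "linear_on Vh ?F" .
  from saddle_point_unique_solution[OF _ this, of "(b - a) / 2"] less
  have "\<exists>!(u, p). u \<in> Vh \<and> p \<in> Qh \<and>
      (\<forall>v\<in>Vh. inner u v + (b - a) / 2 * inner (A u + B' p) v = ?F v) \<and> (\<forall>q\<in>Qh. inner (B u) q = 0)"
    by simp
  then show ?thesis
    by (simp add: S_solutions_def inner_diff_left algebra_simps case_prod_unfold)
qed

text \<open>The integrand is affine in time, so only midpoint values survive. In particular the coefficient
  \<open>r\<close> of the pressure at \<open>a\<close> drops out; the factor \<open>2\<close> is the slope \<open>2 (y - x) / (b - a)\<close>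
  multiplied by the length of the interval.\<close>

lemma momentum_integral:
  assumes "x \<in> Vh" "y \<in> Vh" "c \<in> Vh" and v: "\<And>s. s \<in> J \<Longrightarrow> v s = c"
  shows "(LBINT s:J. inner (vector_derivative (nod x y) (at s within J)) (v s)
      + inner (A (nod x y s)) (v s) + inner (B' (nod r z s)) (v s))
    = 2 * inner (y - x) c + (b - a) * inner (A y + B' z) c"
proof -
  have d: "y - x \<in> Vh" using assms by (simp add: subspace_diff subspace_Vh)
  have "(LBINT s:J. inner (vector_derivative (nod x y) (at s within J)) (v s)
      + inner (A (nod x y s)) (v s) + inner (B' (nod r z s)) (v s))
    = (b - a) * (inner (y - x) c / (m - a) + inner (A y + B' z) c)"
  proof (rule integral_affine[where \<beta> = "(inner (A (y - x)) c + inner (B' (z - r)) c) / (m - a)"])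
    fix s assume s: "s \<in> J"
    define l where "l = (s - m) / (m - a)"
    have "inner (vector_derivative (nod x y) (at s within J)) (v s)
        + inner (A (nod x y s)) (v s) + inner (B' (nod r z s)) (v s)
      = inner (y - x) c / (m - a) + (l * inner (A (y - x)) c + inner (A y) c)
        + (l * inner (B' (z - r)) c + inner (B' z) c)"
      unfolding v[OF s] vector_derivative_nodal[OF s] nodal_eq[OF s] l_def[symmetric]
        inner_A_linear[OF d assms(2,3)] inner_B'_linear[OF assms(3)] by simp
    also have "\<dots> = (s - m) * ((inner (A (y - x)) c + inner (B' (z - r)) c) / (m - a))
        + (inner (y - x) c / (m - a) + inner (A y + B' z) c)"
      by (simp add: l_def inner_add_left add_divide_distrib distrib_left)
    finally show "inner (vector_derivative (nod x y) (at s within J)) (v s)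
        + inner (A (nod x y s)) (v s) + inner (B' (nod r z s)) (v s)
      = (s - m) * ((inner (A (y - x)) c + inner (B' (z - r)) c) / (m - a))
        + (inner (y - x) c / (m - a) + inner (A y + B' z) c)" .
  qed
  also have "\<dots> = 2 * inner (y - x) c + (b - a) * inner (A y + B' z) c"
    using less by (simp add: half field_simps)
  finally show ?thesis .
qed

lemma continuity_integral:
  assumes "x \<in> Vh" "y \<in> Vh" "c \<in> Qh" and q: "\<And>s. s \<in> J \<Longrightarrow> q s = c"
  shows "(LBINT s:J. inner (B (nod x y s)) (q s)) = (b - a) * inner (B y) c"
proof (rule integral_affine[where \<beta> = "inner (B (y - x)) c / (m - a)"])
  have d: "y - x \<in> Vh" using assms by (simp add: subspace_diff subspace_Vh)
  show "inner (B (nod x y s)) (q s) = (s - m) * (inner (B (y - x)) c / (m - a)) + inner (B y) c"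
    if "s \<in> J" for s
    using that by (simp add: q nodal_eq inner_B_linear[OF d] assms)
qed

text \<open>Both time integrals reduce to midpoint values, and half of the resulting momentum equation is the
  one of the space problem. No condition on the coefficient \<open>r\<close> remains.\<close>

lemma nodal_ST_iff:
  assumes "x \<in> Vh" "y \<in> Vh" "r \<in> Qh" "z \<in> Qh"
  shows "(nod x y, nod r z) \<in> ST_sols \<longleftrightarrow> x = u\<^sub>0 \<and> (y, z) \<in> S_sols"
proof -
  have lim: "(nod x y \<longlongrightarrow> u\<^sub>0) (at_right a) \<longleftrightarrow> x = u\<^sub>0"
    using nodal_tendsto tendsto_unique[OF trivial_limit_at_right_real] by blast
  have mom: "(\<forall>v\<in>poly_space 0 J Vh.
        (LBINT s:J. inner (vector_derivative (nod x y) (at s within J)) (v s)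
            + inner (A (nod x y s)) (v s) + inner (B' (nod r z s)) (v s))
        = (b - a) / 2 * (inner (f a) (v b) + inner (f b) (v b)))
    \<longleftrightarrow> (\<forall>c\<in>Vh. 2 * inner (y - x) c + (b - a) * inner (A y + B' z) c
        = (b - a) / 2 * (inner (f a) c + inner (f b) c))"
  proof (rule all_constant_in_time)
    fix v assume "v b \<in> Vh" "\<And>s. s \<in> J \<Longrightarrow> v s = v b"
    note I = momentum_integral[where r = r and z = z, OF assms(1,2) this]
    show "(LBINT s:J. inner (vector_derivative (nod x y) (at s within J)) (v s)
            + inner (A (nod x y s)) (v s) + inner (B' (nod r z s)) (v s))
        = (b - a) / 2 * (inner (f a) (v b) + inner (f b) (v b))
      \<longleftrightarrow> 2 * inner (y - x) (v b) + (b - a) * inner (A y + B' z) (v b)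
        = (b - a) / 2 * (inner (f a) (v b) + inner (f b) (v b))"
      by (subst I) (assumption | rule refl)+
  qed
  have con: "(\<forall>q\<in>poly_space 0 J Qh. (LBINT s:J. inner (B (nod x y s)) (q s)) = 0)
    \<longleftrightarrow> (\<forall>c\<in>Qh. (b - a) * inner (B y) c = 0)"
  proof (rule all_constant_in_time)
    fix q assume "q b \<in> Qh" "\<And>s. s \<in> J \<Longrightarrow> q s = q b"
    note I = continuity_integral[OF assms(1,2) this]
    show "(LBINT s:J. inner (B (nod x y s)) (q s)) = 0 \<longleftrightarrow> (b - a) * inner (B y) (q b) = 0"
      by (subst I) (assumption | rule refl)+
  qed
  have halve: "2 * inner (y - x) c + (b - a) * inner (A y + B' z) c
        = (b - a) / 2 * (inner (f a) c + inner (f b) c)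
      \<longleftrightarrow> inner (y - x) c + (b - a) / 2 * inner (A y + B' z) c = (b - a) / 4 * inner (f a + f b) c" for c
  proof -
    have "2 * X + k * Y = k / 2 * Z \<longleftrightarrow> X + k / 2 * Y = k / 4 * Z" for X Y Z k :: real
      by (auto simp: field_simps)
    then show ?thesis unfolding inner_add_left[of "f a"] .
  qed
  have nonzero: "(b - a) * r = 0 \<longleftrightarrow> r = 0" for r :: real using less by simp
  have poly: "nod x y \<in> poly_space 1 J Vh" "nod r z \<in> poly_space 1 J Qh"
    by (rule nodal_in_poly_space[OF subspace_Vh assms(1,2)] nodal_in_poly_space[OF subspace_Qh assms(3,4)])+
  show ?thesis
    unfolding ST_solutions_def S_solutions_def mem_Collect_eq case_prod_conv lim mom con halve nonzero
    using poly assms by blast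
qed

lemma ST_eq:
  assumes u\<^sub>0: "u\<^sub>0 \<in> Vh" and S: "(u, p) \<in> S_sols"
  shows "ST_sols = {(nod u\<^sub>0 u, nod r p) | r. r \<in> Qh}"
proof (intro equalityI subsetI)
  fix w assume w: "w \<in> ST_sols"
  then obtain w1 w2 where w12: "w = (w1, w2)" "w1 \<in> poly_space 1 J Vh" "w2 \<in> poly_space 1 J Qh"
    by (auto simp: ST_solutions_def)
  obtain x y where xy: "x \<in> Vh" "y \<in> Vh" "w1 = nod x y"
    using poly_space_nodal[OF subspace_Vh w12(2)] .
  obtain r z where rz: "r \<in> Qh" "z \<in> Qh" "w2 = nod r z"
    using poly_space_nodal[OF subspace_Qh w12(3)] .
  have "x = u\<^sub>0" "(y, z) \<in> S_sols"
    using w nodal_ST_iff[OF xy(1,2) rz(1,2)] w12 xy rz by auto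
  moreover from this have "(y, z) = (u, p)" using S_unique_solution S by blast
  ultimately show "w \<in> {(nod u\<^sub>0 u, nod r p) | r. r \<in> Qh}"
    using w12 xy rz by auto
next
  have "u \<in> Vh" "p \<in> Qh" using S by (auto simp: S_solutions_def)
  fix w assume "w \<in> {(nod u\<^sub>0 u, nod r p) | r. r \<in> Qh}"
  then show "w \<in> ST_sols"
    using nodal_ST_iff[OF u\<^sub>0 \<open>u \<in> Vh\<close> _ \<open>p \<in> Qh\<close>] S by auto
qed

end

theorem lemma3p4:
  fixes \<Omega> :: "(real ^ 'd) set"
    and T \<beta> :: real
    and t :: "nat \<Rightarrow> real"
    and N n :: nat
    and Vh :: "(real ^ 'd, real ^ 'd) L2 set"
    and Qh :: "(real ^ 'd, real) L2 set"
    and f :: "real \<Rightarrow> (real ^ 'd, real ^ 'd) L2"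
    and u_prev :: "(real ^ 'd, real ^ 'd) L2"
    and \<phi>\<^sub>0 \<phi>\<^sub>1 :: "real \<Rightarrow> real"
    and t_mid :: real
  assumes dim: "CARD('d) \<in> {2, 3}"
    and domain: "open \<Omega>" "bounded \<Omega>" "connected \<Omega>" "\<Omega> \<noteq> {}"
    and mesh: "0 < T" "t 0 = 0" "t N = T" "\<forall>i<N. t i < t (Suc i)"
    and Vh: "finite_dim_subspace Vh" "Vh \<subseteq> V_space \<Omega>"
    and Qh: "finite_dim_subspace Qh" "Qh \<subseteq> Q_space \<Omega>"
    and inf_sup: "inf_sup_condition \<Omega> Vh Qh \<beta>"
    and force: "\<forall>s\<in>{0..T}. f s \<in> L2_on \<Omega>" "continuous_on {0..T} f"
    and n: "n \<in> {1..N}"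
    and u_prev: "u_prev \<in> Vh_div \<Omega> Vh Qh"
    and t_mid: "t_mid = (t (n - 1) + t n) / 2"
    and phi0: "\<phi>\<^sub>0 \<in> poly_space 1 {t (n - 1)..t n} UNIV" "\<phi>\<^sub>0 (t (n - 1)) = 1" "\<phi>\<^sub>0 t_mid = 0"
    and phi1: "\<phi>\<^sub>1 \<in> poly_space 1 {t (n - 1)..t n} UNIV" "\<phi>\<^sub>1 (t (n - 1)) = 0" "\<phi>\<^sub>1 t_mid = 1"
  shows "(\<exists>!z. z \<in> S_solutions \<Omega> Vh Qh f (t (n - 1)) (t n) u_prev) \<and>
    (\<forall>u_bar p_bar. (u_bar, p_bar) \<in> S_solutions \<Omega> Vh Qh f (t (n - 1)) (t n) u_prev \<longrightarrow>
       ST_solutions \<Omega> Vh Qh f (t (n - 1)) (t n) u_prev =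
         {(nodal {t (n - 1)<..t n} \<phi>\<^sub>0 \<phi>\<^sub>1 u_prev u_bar, nodal {t (n - 1)<..t n} \<phi>\<^sub>0 \<phi>\<^sub>1 p_prev p_bar)
           | p_prev. p_prev \<in> Qh} \<and>
       (\<forall>p_prev\<in>Qh. \<forall>u p.
          u = nodal {t (n - 1)<..t n} \<phi>\<^sub>0 \<phi>\<^sub>1 u_prev u_bar \<and>
          p = nodal {t (n - 1)<..t n} \<phi>\<^sub>0 \<phi>\<^sub>1 p_prev p_bar \<longrightarrow>
            (u \<longlongrightarrow> u_prev) (at_right (t (n - 1))) \<and> (p \<longlongrightarrow> p_prev) (at_right (t (n - 1))) \<and>
            u t_mid = u_bar \<and> p t_mid = p_bar))"
proof -
  obtain k where k: "n = Suc k" "k < N" using n by (cases n) auto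
  have slab: "t (n - 1) < t n" using mesh(4) k by simp
  interpret stokes_slab \<Omega> Vh Qh "t (n - 1)" "t n" t_mid \<phi>\<^sub>0 \<phi>\<^sub>1 f u_prev
    by unfold_locales
      (use domain Vh Qh inf_sup_imp_div_faithful[OF inf_sup] slab t_mid phi0 phi1 in blast)+
  have "u_prev \<in> Vh" using u_prev by (simp add: Vh_div_def)
  show ?thesis
  proof (intro conjI allI impI ballI)
    show "\<exists>!z. z \<in> S_sols" by (rule S_unique_solution)
    fix u_bar p_bar assume S: "(u_bar, p_bar) \<in> S_sols"
    show "ST_sols = {(nod u_prev u_bar, nod p_prev p_bar) | p_prev. p_prev \<in> Qh}"
      by (rule ST_eq[OF \<open>u_prev \<in> Vh\<close> S])
    fix p_prev u p
    assume "u = nod u_prev u_bar \<and> p = nod p_prev p_bar"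
    then show "(u \<longlongrightarrow> u_prev) (at_right (t (n - 1)))" "(p \<longlongrightarrow> p_prev) (at_right (t (n - 1)))"
      "u t_mid = u_bar" "p t_mid = p_bar"
      using nodal_tendsto nodal_at_mid by auto
  qed
qed

end
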